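(* If $A$ is a factor with $\dim A\geq 3$, then $\Gamma^{+}(A)$ is a connected graph whose diameter is not greater than $6$.
   Context: $H$ denotes an infinite dimensional separable Hilbert space. A von Neumann algebra is a $C^{*}$-subalgebra of $B(H)$ which contains the identity operator and is closed in the weak operator topology; a factor is a von Neumann algebra with trivial center. For a $C^{*}$-algebra $A$, $\Gamma^{+}(A)$ is the undirected graph whose vertices are the nonzero positive zero divisors of $A$ (nonzero positive $a\in A$ for which there is a nonzero $b\in A$ with $ab=0$), two distinct vertices $a,b$ being joined by an edge if and only if $ab=0$. A graph is connected if any two vertices are joined by a path of edges; $d(a,b)$ is the infimum of the lengths of paths connecting $a$ to $b$, and the diameter of a connected graph is the supremum of $d(a,b)$ over all pairs of vertices.
   Formalization: Here dim A ≥ 3 means that A has three mutually orthogonal nonzero projections, not vector space dimension ≥ 3; this excludes exactly the type I_2 factors (A ≅ M_2(C), vector space dimension 4), for which the graph is disconnected and the claim fails. *)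

theory Defs
  imports "Graph_Theory.Graph_Theory" "HOL-Analysis.Analysis"
begin

section \<open>Complex Hilbert spaces\<close>

text \<open>
  A complex Hilbert space is presented together with its underlying real Hilbert space: the
  library's real inner product is the real part of the complex one, so that norm, metric and
  topology are the library's. The complex inner product is linear in the first argument.
\<close>

class complex_hilbert_space = real_inner + banach +
  fixes scaleC :: "complex \<Rightarrow> 'a \<Rightarrow> 'a"  (infixr \<open>*\<^sub>C\<close> 75)
    and cinner :: "'a \<Rightarrow> 'a \<Rightarrow> complex"
  assumes scaleC_add_right: "c *\<^sub>C (x + y) = c *\<^sub>C x + c *\<^sub>C y"
    and scaleC_add_left: "(c + d) *\<^sub>C x = c *\<^sub>C x + d *\<^sub>C x"
    and scaleC_scaleC: "c *\<^sub>C d *\<^sub>C x = (c * d) *\<^sub>C x"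
    and scaleC_of_real: "complex_of_real r *\<^sub>C x = r *\<^sub>R x"
    and cinner_commute: "cinner x y = cnj (cinner y x)"
    and cinner_add_left: "cinner (x + y) z = cinner x z + cinner y z"
    and cinner_scaleC_left: "cinner (c *\<^sub>C x) y = c * cinner x y"
    and Re_cinner: "Re (cinner x y) = inner x y"

instantiation complex :: complex_hilbert_space
begin

definition "scaleC_complex = ((*) :: complex \<Rightarrow> complex \<Rightarrow> complex)"
definition "cinner_complex x y = x * cnj (y :: complex)"

instance
  by standard
    (auto simp: scaleC_complex_def cinner_complex_def inner_complex_def scaleR_conv_of_real
      algebra_simps)

end

global_interpretation complex_vector:
  vector_space "scaleC :: complex \<Rightarrow> 'a \<Rightarrow> 'a :: complex_hilbert_space"
proof
  fix x :: 'a
  show "1 *\<^sub>C x = x"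
    using scaleC_of_real[of 1 x] by simp
qed (simp_all add: scaleC_add_right scaleC_add_left scaleC_scaleC)

definition infinite_dimensional :: "'a :: complex_hilbert_space itself \<Rightarrow> bool" where
  "infinite_dimensional _ \<longleftrightarrow> \<not> (\<exists>B :: 'a set. finite B \<and> complex_vector.span B = UNIV)"

definition separable :: "'a :: complex_hilbert_space itself \<Rightarrow> bool" where
  "separable _ \<longleftrightarrow> separable_space (euclidean :: 'a topology)"

lemma norm_scaleC: "norm (c *\<^sub>C x) = cmod c * norm (x :: 'a :: complex_hilbert_space)"
proof -
  have *: "cinner y y = complex_of_real ((norm y)\<^sup>2)" for y :: 'a
  proof -
    have "Im (cinner y y) = 0"
      using cinner_commute[of y y] by (simp add: complex_eq_iff)
    then show ?thesis
      by (simp add: complex_eq_iff Re_cinner power2_norm_eq_inner)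
  qed
  have "cinner (c *\<^sub>C x) (c *\<^sub>C x) = c * cnj c * cinner x x"
    using cinner_commute[of x "c *\<^sub>C x"] cinner_commute[of x x]
    by (simp add: cinner_scaleC_left)
  then have "complex_of_real ((norm (c *\<^sub>C x))\<^sup>2) = of_real ((cmod c * norm x)\<^sup>2)"
    unfolding * complex_norm_square[symmetric] by (simp add: power_mult_distrib)
  then have "(norm (c *\<^sub>C x))\<^sup>2 = (cmod c * norm x)\<^sup>2"
    using of_real_eq_iff by blast
  then show ?thesis
    by (simp add: power2_eq_iff_nonneg)
qed

section \<open>Bounded operators\<close>

text \<open>
  The type \<^typ>\<open>'a \<Rightarrow>\<^sub>L 'a\<close> consists of the bounded real-linear maps; the algebra \<open>B(H)\<close> is its
  subset of complex-linear maps, with the same operator norm.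
\<close>

definition bounded_operators :: "('a :: complex_hilbert_space \<Rightarrow>\<^sub>L 'a) set" where
  "bounded_operators = {T :: 'a \<Rightarrow>\<^sub>L 'a. \<forall>c x. T (c *\<^sub>C x) = c *\<^sub>C T x}"

lift_definition scaleC_op ::
  "complex \<Rightarrow> ('a :: complex_hilbert_space \<Rightarrow>\<^sub>L 'a) \<Rightarrow> 'a \<Rightarrow>\<^sub>L 'a" is "\<lambda>c T x. c *\<^sub>C T x"
proof -
  fix c :: complex and T :: "'a \<Rightarrow> 'a"
  assume T: "bounded_linear T"
  have "bounded_linear (\<lambda>x :: 'a. c *\<^sub>C x)"
  proof (rule bounded_linear_intro[where K = "cmod c"])
    show "c *\<^sub>C r *\<^sub>R x = r *\<^sub>R c *\<^sub>C x" for r and x :: 'a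
      by (simp add: scaleC_of_real[symmetric] scaleC_scaleC mult.commute)
  qed (simp_all add: scaleC_add_right norm_scaleC)
  then show "bounded_linear (\<lambda>x. c *\<^sub>C T x)"
    using T by (rule bounded_linear_compose)
qed

text \<open>
  \<open>is_adjoint S T\<close> says that \<open>T\<close> is the Hilbert space adjoint of \<open>S\<close>, which exists and is unique
  for every complex-linear \<open>S\<close>.
\<close>

definition is_adjoint ::
  "('a :: complex_hilbert_space \<Rightarrow>\<^sub>L 'a) \<Rightarrow> ('a \<Rightarrow>\<^sub>L 'a) \<Rightarrow> bool" where
  "is_adjoint S T \<longleftrightarrow> (\<forall>x y. cinner (S x) y = cinner x (T y))"

definition positive_operator :: "('a :: complex_hilbert_space \<Rightarrow>\<^sub>L 'a) \<Rightarrow> bool" where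
  "positive_operator T \<longleftrightarrow> (\<forall>x. cinner (T x) x \<in> \<real>\<^sub>\<ge>\<^sub>0)"

definition projection :: "('a :: complex_hilbert_space \<Rightarrow>\<^sub>L 'a) \<Rightarrow> bool" where
  "projection P \<longleftrightarrow> is_adjoint P P \<and> P o\<^sub>L P = P"

text \<open>
  The coarsest topology on \<open>B(H)\<close> making all maps \<open>T \<mapsto> \<langle>T x, y\<rangle>\<close> continuous; the topology on the
  function space \<open>H \<times> H \<Rightarrow> \<complex>\<close> is that of pointwise convergence.
\<close>

definition weak_operator_topology :: "('a :: complex_hilbert_space \<Rightarrow>\<^sub>L 'a) topology" where
  "weak_operator_topology =
     pullback_topology bounded_operators (\<lambda>(T :: 'a \<Rightarrow>\<^sub>L 'a) (x, y). cinner (T x) y) euclidean"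

section \<open>Von Neumann algebras and factors\<close>

definition cstar_subalgebra :: "('a :: complex_hilbert_space \<Rightarrow>\<^sub>L 'a) set \<Rightarrow> bool" where
  "cstar_subalgebra A \<longleftrightarrow>
     A \<subseteq> bounded_operators \<and>
     0 \<in> A \<and>
     (\<forall>S\<in>A. \<forall>T\<in>A. S + T \<in> A) \<and>
     (\<forall>c. \<forall>T\<in>A. scaleC_op c T \<in> A) \<and>
     (\<forall>S\<in>A. \<forall>T\<in>A. S o\<^sub>L T \<in> A) \<and>
     (\<forall>S\<in>A. \<exists>T\<in>A. is_adjoint S T) \<and>
     closed A"

definition von_neumann_algebra :: "('a :: complex_hilbert_space \<Rightarrow>\<^sub>L 'a) set \<Rightarrow> bool" where
  "von_neumann_algebra A \<longleftrightarrow>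
     cstar_subalgebra A \<and> id_blinfun \<in> A \<and> closedin weak_operator_topology A"

definition center :: "('a :: complex_hilbert_space \<Rightarrow>\<^sub>L 'a) set \<Rightarrow> ('a \<Rightarrow>\<^sub>L 'a) set" where
  "center A = {S \<in> A. \<forall>T\<in>A. S o\<^sub>L T = T o\<^sub>L S}"

definition factor :: "('a :: complex_hilbert_space \<Rightarrow>\<^sub>L 'a) set \<Rightarrow> bool" where
  "factor A \<longleftrightarrow> von_neumann_algebra A \<and> center A = range (\<lambda>c. scaleC_op c id_blinfun)"

text \<open>
  The dimension of a factor is its order, in the sense of the type classification: the largest
  number of mutually orthogonal nonzero projections. It is \<open>n\<close> for a factor of type \<open>I\<^sub>n\<close>, that is,
  for \<open>A \<cong> M\<^sub>n(\<complex>)\<close>, and \<open>\<infinity>\<close> for every other factor. This is deliberately not the dimension of \<open>A\<close>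
  as a vector space (\<open>n\<^sup>2\<close> for type \<open>I\<^sub>n\<close>): a lower bound of \<open>3\<close> on the latter admits
  \<open>M\<^sub>2(\<complex>) \<otimes> 1\<close> on \<open>\<complex>\<^sup>2 \<otimes> H\<close>, whose positive zero divisor graph is disconnected, because for
  a projection \<open>p\<close> of rank one the positive multiples of \<open>p \<otimes> 1\<close> and \<open>(1 - p) \<otimes> 1\<close> form a
  connected component. The two dimensions give the same condition \<open>\<ge> 3\<close> on all factors except
  those of type \<open>I\<^sub>2\<close>.
\<close>

definition factor_dim :: "('a :: complex_hilbert_space \<Rightarrow>\<^sub>L 'a) set \<Rightarrow> enat" where
  "factor_dim A =
     (SUP F \<in> {F. finite F \<and> F \<subseteq> {P \<in> A. projection P \<and> P \<noteq> 0} \<and>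
                  pairwise (\<lambda>P Q. P o\<^sub>L Q = 0) F}. enat (card F))"

section \<open>The positive zero divisor graph\<close>

definition positive_zero_divisors ::
  "('a :: complex_hilbert_space \<Rightarrow>\<^sub>L 'a) set \<Rightarrow> ('a \<Rightarrow>\<^sub>L 'a) set" where
  "positive_zero_divisors A =
     {a \<in> A. positive_operator a \<and> a \<noteq> 0 \<and> (\<exists>b\<in>A. b \<noteq> 0 \<and> a o\<^sub>L b = 0)}"

text \<open>
  An undirected graph is a digraph with a symmetric arc relation; here symmetry holds because
  \<open>b a = (a b)\<^sup>*\<close> for self-adjoint \<open>a\<close> and \<open>b\<close>.
\<close>

definition zero_divisor_graph ::
  "('a :: complex_hilbert_space \<Rightarrow>\<^sub>L 'a) set \<Rightarrow> ('a \<Rightarrow>\<^sub>L 'a) pair_pre_digraph" where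
  "zero_divisor_graph A =
     \<lparr>pverts = positive_zero_divisors A,
      parcs = {(a, b). a \<in> positive_zero_divisors A \<and> b \<in> positive_zero_divisors A \<and>
                       a \<noteq> b \<and> a o\<^sub>L b = 0}\<rparr>"

definition graph_dist :: "('v, 'e) pre_digraph \<Rightarrow> 'v \<Rightarrow> 'v \<Rightarrow> ereal" where
  "graph_dist G u v = wf_digraph.\<mu> G (\<lambda>_. 1) u v"

definition graph_diameter :: "('v, 'e) pre_digraph \<Rightarrow> ereal" where
  "graph_diameter G = (SUP (u, v) \<in> verts G \<times> verts G. graph_dist G u v)"

end

theory Submission
  imports Defs
begin

text \<open>
  Let \<open>a\<close> and \<open>b\<close> be positive zero divisors, let \<open>p\<close> and \<open>q\<close> be the projections onto their kernels,
  which lie in \<open>A\<close>, and put \<open>r = 1 - p\<close>, \<open>s = 1 - q\<close>.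

  Suppose that the corner \<open>r A r\<close> contains a self-adjoint element that is not a multiple of \<open>r\<close>.
  Splitting a suitable such element into its positive and negative parts, namely \<open>r s r\<close> if it is not
  a multiple of \<open>r\<close>, gives nonzero self-adjoint \<open>u\<close> and \<open>v\<close> in \<open>r A r\<close> with \<open>u s v = u (r s r) v = 0\<close>.
  Then \<open>a, p, u\<^sup>2, s v\<^sup>2 s, q, b\<close> is a walk, or \<open>a, p, v\<^sup>2, b\<close> in case \<open>s v = 0\<close>. The situation is
  symmetric in \<open>r\<close> and \<open>s\<close>.

  Otherwise \<open>r\<close> and \<open>s\<close> are minimal projections. A factor is a prime algebra: if \<open>y A x = 0\<close>, the
  common kernel of all \<open>y u\<close> is \<open>A\<close>-invariant, and separability makes it the kernel of a single
  element of \<open>A\<close>, so that its projection is central. Hence three orthogonal projections \<open>e\<^sub>i\<close> give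
  three linearly independent operators \<open>e\<^sub>i u\<^sub>i r\<close>. By minimality, \<open>r w = 0\<close> and \<open>s w = 0\<close>
  are one linear equation each on their span, so a nonzero solution \<open>w\<close> exists, and \<open>a, w w\<^sup>*, b\<close>
  is a walk.
\<close>

section \<open>Adjoints of bounded operators\<close>

lemma cinner_add_right: "cinner x (y + z) = cinner x y + cinner x z"
  by (metis cinner_add_left cinner_commute complex_cnj_add)

lemma cinner_diff_left: "cinner (x - y) z = cinner x z - cinner y z"
  by (metis add_diff_cancel_right' cinner_add_left diff_add_cancel)

lemma cinner_diff_right: "cinner x (y - z) = cinner x y - cinner x z"
  by (metis add_diff_cancel_right' cinner_add_right diff_add_cancel)

lemma cinner_scaleC_right: "cinner x (c *\<^sub>C y) = cnj c * cinner x y"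
  by (metis cinner_scaleC_left cinner_commute complex_cnj_mult)

lemma cinner_scaleR_left: "cinner (r *\<^sub>R x) y = of_real r * cinner x y"
  by (metis cinner_scaleC_left scaleC_of_real)

lemma cinner_scaleR_right: "cinner x (r *\<^sub>R y) = of_real r * cinner x y"
  by (metis cinner_scaleC_right complex_cnj_complex_of_real scaleC_of_real)

lemma cinner_self: "cinner x x = of_real ((norm x)\<^sup>2)"
proof -
  have "Im (cinner x x) = 0"
    using cinner_commute[of x x] by (simp add: complex_eq_iff)
  then show ?thesis
    by (simp add: complex_eq_iff Re_cinner power2_norm_eq_inner)
qed

lemma cinner_zero [simp]: "cinner 0 x = 0" "cinner x 0 = 0"
  using cinner_diff_left[of x x x] cinner_diff_left[of 0 0 x] cinner_diff_right[of x 0 0] by auto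

lemma Im_cinner: "Im (cinner x y) = inner x (\<i> *\<^sub>C y)"
  by (simp flip: Re_cinner add: cinner_scaleC_right)

lemma tendsto_cinner_left:
  assumes "(f \<longlongrightarrow> l) F"
  shows "((\<lambda>n. cinner (f n) y) \<longlongrightarrow> cinner l y) F"
proof -
  have "((\<lambda>n. Complex (inner (f n) y) (inner (f n) (\<i> *\<^sub>C y))) \<longlongrightarrow>
      Complex (inner l y) (inner l (\<i> *\<^sub>C y))) F"
    by (intro tendsto_intros assms)
  then show ?thesis
    by (simp only: Im_cinner[symmetric]) (simp flip: Re_cinner)
qed

text \<open>Polarization: expanding at \<open>x + y\<close> gives
  \<open>cinner (D x) y = - cinner (D y) x\<close>, and replacing \<open>y\<close> by its multiple
  by the imaginary unit turns the sign around, so both sides vanish.\<close>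

lemma bounded_operators_cinner_eq_0:
  assumes "D \<in> bounded_operators" and zero: "\<And>x. cinner (D x) x = 0"
  shows "D = 0"
proof (rule blinfun_eqI)
  fix x
  have *: "cinner (D x) y + cinner (D y) x = 0" for x y
    using zero[of "x + y"] zero[of x] zero[of y]
    by (simp add: blinfun.add_right cinner_add_left cinner_add_right add.commute)
  have "D (\<i> *\<^sub>C x) = \<i> *\<^sub>C D x" for x
    using assms(1) by (simp add: bounded_operators_def)
  then have "cinner (D x) y = cinner (D y) x" for x y
    using *[of x "\<i> *\<^sub>C y"] by (simp add: cinner_scaleC_left cinner_scaleC_right)
  then have "cinner (D x) (D x) = 0"
    using *[of x "D x"] by simp
  then show "D x = blinfun_apply 0 x"
    by (simp add: cinner_self)
qed

lemma blinfun_compose_assoc: "(R o\<^sub>L S) o\<^sub>L T = R o\<^sub>L (S o\<^sub>L T)"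
  by (rule blinfun_eqI) simp

lemma is_adjoint_inner: "is_adjoint S T \<Longrightarrow> inner (S x) y = inner x (T y)"
  by (metis Re_cinner is_adjoint_def)

lemma is_adjoint_sym: "is_adjoint S T \<Longrightarrow> is_adjoint T S"
  unfolding is_adjoint_def by (metis cinner_commute)

lemma is_adjoint_compose:
  "is_adjoint S S' \<Longrightarrow> is_adjoint T T' \<Longrightarrow> is_adjoint (S o\<^sub>L T) (T' o\<^sub>L S')"
  by (simp add: is_adjoint_def)

lemma is_adjoint_add: "is_adjoint S S' \<Longrightarrow> is_adjoint T T' \<Longrightarrow> is_adjoint (S + T) (S' + T')"
  by (simp add: is_adjoint_def blinfun.add_left cinner_add_left cinner_add_right)

lemma is_adjoint_diff: "is_adjoint S S' \<Longrightarrow> is_adjoint T T' \<Longrightarrow> is_adjoint (S - T) (S' - T')"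
  by (simp add: is_adjoint_def blinfun.diff_left cinner_diff_left cinner_diff_right)

lemma is_adjoint_scaleR: "is_adjoint S T \<Longrightarrow> is_adjoint (r *\<^sub>R S) (r *\<^sub>R T)"
  by (simp add: is_adjoint_def blinfun.scaleR_left cinner_scaleR_left cinner_scaleR_right)

lemma is_adjoint_0: "is_adjoint 0 0"
  by (simp add: is_adjoint_def)

lemma is_adjoint_id: "is_adjoint id_blinfun id_blinfun"
  by (simp add: is_adjoint_def)

lemma is_adjoint_unique:
  assumes "is_adjoint S T" "is_adjoint S T'"
  shows "T = T'"
proof (rule blinfun_eqI)
  fix y
  have "cinner x (T y - T' y) = 0" for x
    using assms by (simp add: is_adjoint_def cinner_diff_right)
  from this[of "T y - T' y"] show "T y = T' y"
    by (simp add: cinner_self)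
qed

lemma is_adjoint_limit:
  assumes "S \<longlonglongrightarrow> s" and "\<And>n. is_adjoint (S n) (S n)"
  shows "is_adjoint s s"
proof -
  have lim: "(\<lambda>n. S n x) \<longlonglongrightarrow> s x" for x
    by (intro tendsto_intros assms(1))
  have "(\<lambda>n. cinner x (S n y)) \<longlonglongrightarrow> cinner x (s y)" for x y
    using tendsto_cnj[OF tendsto_cinner_left[OF lim[of y], of x]] by (simp flip: cinner_commute)
  moreover have "(\<lambda>n. cinner x (S n y)) \<longlonglongrightarrow> cinner (s x) y" for x y
    using tendsto_cinner_left[OF lim[of x], of y] assms(2) by (simp add: is_adjoint_def)
  ultimately show ?thesis
    unfolding is_adjoint_def using LIMSEQ_unique by blast
qed

text \<open>A nonnegative quadratic form is real, so \<open>T\<close> and its adjoint have the same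
  form and coincide by polarization. This makes all vertices of the graph self-adjoint.\<close>

lemma positive_operator_is_adjoint:
  assumes "T \<in> bounded_operators" "is_adjoint T T'" "T' \<in> bounded_operators" "positive_operator T"
  shows "is_adjoint T T"
proof -
  have "cinner (T x) x = cinner (T' x) x" for x
  proof -
    have "cinner (T x) x \<in> \<real>"
      using assms(4) nonneg_Reals_subset_Reals by (auto simp: positive_operator_def)
    then have "cinner (T x) x = cnj (cinner x (T' x))"
      using assms(2) by (auto simp: is_adjoint_def Reals_cnj_iff)
    then show ?thesis
      by (simp flip: cinner_commute)
  qed
  then have "cinner ((T - T') x) x = 0" for x
    by (simp add: blinfun.diff_left cinner_diff_left)
  moreover have "T - T' \<in> bounded_operators"
    using assms(1,3)
    by (auto simp: bounded_operators_def blinfun.diff_left complex_vector.scale_right_diff_distrib)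
  ultimately have "T - T' = 0"
    using bounded_operators_cinner_eq_0 by blast
  then show ?thesis
    using assms(2) by simp
qed

lemma positive_operator_adjoint_compose: "is_adjoint S T \<Longrightarrow> positive_operator (T o\<^sub>L S)"
  unfolding positive_operator_def
  by (metis blinfun_apply_blinfun_compose cinner_self is_adjoint_def is_adjoint_sym
      nonneg_Reals_of_real_iff zero_le_power2)

lemma is_adjoint_compose_eq_0:
  assumes "is_adjoint S T" "T o\<^sub>L S = 0"
  shows "S = 0"
proof (rule blinfun_eqI)
  fix x
  have "cinner (S x) (S x) = cinner x ((T o\<^sub>L S) x)"
    using assms(1) by (simp add: is_adjoint_def)
  then show "S x = blinfun_apply 0 x"
    by (simp add: assms(2) cinner_self)
qed

text \<open>Symmetry takes the place of complex polarization: expanding at \<open>x + S x\<close>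
  leaves twice the square of the norm of \<open>S x\<close>.\<close>

lemma self_adjoint_inner_eq_0:
  assumes "is_adjoint S S" and zero: "\<And>x. inner (S x) x = 0"
  shows "S = 0"
proof (rule blinfun_eqI)
  fix x
  have "inner (S (S x)) x = inner (S x) (S x)"
    using assms(1) is_adjoint_inner by blast
  then have "inner (S x) (S x) = 0"
    using zero[of "x + S x"] zero[of x] zero[of "S x"]
    by (simp add: blinfun.add_right inner_add_left inner_add_right)
  then show "S x = blinfun_apply 0 x"
    by simp
qed

lemma self_adjoint_compose_commute:
  assumes "is_adjoint S S" "is_adjoint T T" "S o\<^sub>L T = 0"
  shows "T o\<^sub>L S = 0"
  using is_adjoint_unique[OF is_adjoint_compose[OF assms(1,2)], of 0] assms(3) is_adjoint_0 by auto

text \<open>Expand the square and use that \<open>k (k x)\<close> is no longer than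
  \<open>k x\<close>. Thus 1 - k^2 is a contraction that strictly shrinks every vector outside the
  kernel of \<open>k\<close>.\<close>

lemma norm_diff_square_le:
  assumes k: "is_adjoint k k" "norm k \<le> 1"
  shows "(norm (x - k (k x)))\<^sup>2 \<le> (norm x)\<^sup>2 - (norm (k x))\<^sup>2"
proof -
  have "norm (k (k x)) \<le> norm (k x)"
    by (metis k(2) mult_left_le_one_le norm_blinfun norm_ge_zero order_trans)
  then have "(norm (k (k x)))\<^sup>2 \<le> (norm (k x))\<^sup>2"
    by (simp add: power_mono)
  moreover have "inner x (k (k x)) = (norm (k x))\<^sup>2"
    by (simp add: power2_norm_eq_inner is_adjoint_inner[OF k(1)])
  then have "(norm (x - k (k x)))\<^sup>2 = (norm x)\<^sup>2 - 2 * (norm (k x))\<^sup>2 + (norm (k (k x)))\<^sup>2"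
    by (simp add: power2_norm_eq_inner inner_diff_left inner_diff_right inner_commute)
  ultimately show ?thesis
    by linarith
qed

lemma projection_apply: "projection P \<Longrightarrow> P (P x) = P x"
  by (metis blinfun_apply_blinfun_compose projection_def)

lemma projection_positive: "projection P \<Longrightarrow> positive_operator P"
  by (metis positive_operator_adjoint_compose projection_def)

section \<open>Kernel projections in a von Neumann algebra\<close>

locale von_neumann =
  fixes A :: "('h :: complex_hilbert_space \<Rightarrow>\<^sub>L 'h) set"
  assumes vN: "von_neumann_algebra A"
begin

lemma mem_bounded: "S \<in> A \<Longrightarrow> S \<in> bounded_operators"
  and mem_0: "0 \<in> A"
  and mem_add: "S \<in> A \<Longrightarrow> T \<in> A \<Longrightarrow> S + T \<in> A"
  and mem_scaleC: "S \<in> A \<Longrightarrow> scaleC_op c S \<in> A"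
  and mem_compose: "S \<in> A \<Longrightarrow> T \<in> A \<Longrightarrow> S o\<^sub>L T \<in> A"
  and mem_adjoint: "S \<in> A \<Longrightarrow> \<exists>T\<in>A. is_adjoint S T"
  and closed: "closed A"
  and mem_id: "id_blinfun \<in> A"
  using vN unfolding von_neumann_algebra_def cstar_subalgebra_def by blast+

lemma mem_scaleR: "S \<in> A \<Longrightarrow> r *\<^sub>R S \<in> A"
proof -
  have "scaleC_op (of_real r) S = r *\<^sub>R S"
    by (rule blinfun_eqI) (simp add: scaleC_op.rep_eq scaleC_of_real blinfun.scaleR_left)
  then show "S \<in> A \<Longrightarrow> r *\<^sub>R S \<in> A"
    by (metis mem_scaleC)
qed

lemma mem_diff: "S \<in> A \<Longrightarrow> T \<in> A \<Longrightarrow> S - T \<in> A"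
  using mem_add[of S "(-1) *\<^sub>R T"] mem_scaleR[of T "-1"] by simp

lemma mem_sum: "(\<And>i. i \<in> I \<Longrightarrow> S i \<in> A) \<Longrightarrow> (\<Sum>i\<in>I. S i) \<in> A"
  by (induction I rule: infinite_finite_induct) (auto simp: mem_0 mem_add)

lemma mem_limit: "S \<longlonglongrightarrow> s \<Longrightarrow> (\<And>n. S n \<in> A) \<Longrightarrow> s \<in> A"
  using closed closed_sequentially by blast

text \<open>Weak closedness of \<open>A\<close> enters here: pointwise convergence implies
  convergence of all matrix coefficients \<open>cinner (S n x) y\<close>. Norm closedness does not
  capture such limits.\<close>

lemma mem_strong_limit:
  fixes P :: "'h \<Rightarrow>\<^sub>L 'h"
  assumes "\<And>n. S n \<in> A" and lim: "\<And>x. (\<lambda>n. S n x) \<longlonglongrightarrow> P x"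
  shows "P \<in> A"
proof -
  let ?f = "\<lambda>(T :: 'h \<Rightarrow>\<^sub>L 'h) (x, y). cinner (T x) y"
  \<comment> \<open>The weak operator topology lives on \<open>bounded_operators\<close>, so complex
    linearity of the limit has to be known before closedness can be applied to it.\<close>
  have bounded: "P \<in> bounded_operators"
  proof -
    have "P (c *\<^sub>C x) = c *\<^sub>C P x" for c x
    proof -
      have "(\<lambda>n. c *\<^sub>C S n x) \<longlonglongrightarrow> c *\<^sub>C P x"
        using blinfun.tendsto[OF tendsto_const lim[of x], of "scaleC_op c id_blinfun"]
        by (simp add: scaleC_op.rep_eq)
      moreover have "c *\<^sub>C S n x = S n (c *\<^sub>C x)" for n
        using mem_bounded[OF assms(1)[of n]] by (simp add: bounded_operators_def)
      ultimately show ?thesis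
        using lim[of "c *\<^sub>C x"] LIMSEQ_unique by auto
    qed
    then show ?thesis
      by (simp add: bounded_operators_def)
  qed
  have top: "topspace (weak_operator_topology :: ('h \<Rightarrow>\<^sub>L 'h) topology) = bounded_operators"
    by (simp add: weak_operator_topology_def topspace_pullback_topology)
  have "closedin weak_operator_topology A"
    using vN by (simp add: von_neumann_algebra_def)
  then have "openin weak_operator_topology (bounded_operators - A)"
    by (simp add: closedin_def top)
  then obtain U where U: "open U" "bounded_operators - A = ?f -` U \<inter> bounded_operators"
    by (auto simp: weak_operator_topology_def openin_pullback_topology)
  \<comment> \<open>The function space carries the product topology, so convergence is checked at
    each pair \<open>(x, y)\<close> separately.\<close>
  have "(\<lambda>n. ?f (S n)) \<longlonglongrightarrow> ?f P"
  proof -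
    have "limitin euclidean (\<lambda>n. ?f (S n)) (?f P) sequentially"
      unfolding euclidean_product_topology[symmetric] limitin_componentwise
      by (auto simp: tendsto_cinner_left[OF lim])
    then show ?thesis
      by simp
  qed
  show ?thesis
  proof (rule ccontr)
    assume "P \<notin> A"
    then have "?f P \<in> U"
      using U(2) bounded by blast
    then have "\<forall>\<^sub>F n in sequentially. ?f (S n) \<in> U"
      using \<open>(\<lambda>n. ?f (S n)) \<longlonglongrightarrow> ?f P\<close> U(1) topological_tendstoD by blast
    then obtain n where "?f (S n) \<in> U"
      using eventually_happens by fastforce
    then show False
      using U(2) assms(1) mem_bounded by blast
  qed
qed

text \<open>The even powers of a self-adjoint contraction converge strongly to the projection onto
  the fixed points of its square. Odd powers are left out because \<open>T\<close> may have
  eigenvalue -1.\<close>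

lemma fixed_point_projection:
  assumes T: "T \<in> A" "is_adjoint T T" and contr: "\<And>x. norm (T x) \<le> norm x"
  obtains P where "P \<in> A" "projection P" "\<And>x. P x = x \<longleftrightarrow> T (T x) = x"
proof -
  define Q where "Q n = ((\<lambda>S. T o\<^sub>L S) ^^ n) id_blinfun" for n
  have Q_0 [simp]: "Q 0 = id_blinfun" and Q_Suc: "Q (Suc n) = T o\<^sub>L Q n" for n
    by (simp_all add: Q_def)
  have Q_mem: "Q n \<in> A" for n
    by (induction n) (simp_all add: Q_Suc mem_id mem_compose T)
  have Q_add: "Q (m + n) x = Q m (Q n x)" for m n x
    by (induction m) (simp_all add: Q_Suc)
  have Q_adj: "cinner (Q n x) y = cinner x (Q n y)" for n x y
  proof (induction n arbitrary: x y)
    case (Suc n)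
    have "T (Q n y) = Q n (T y)"
      using Q_add[of 1 n y] Q_add[of n 1 y] by (simp add: Q_Suc)
    then show ?case
      using T(2) Suc by (simp add: Q_Suc is_adjoint_def)
  qed simp
  then have Q_inner: "inner (Q n x) y = inner x (Q n y)" for n x y
    by (metis Re_cinner)
  have Q_norm: "norm (Q n x) \<le> norm x" for n x
    by (induction n) (auto simp: Q_Suc intro: order_trans[OF contr])
  \<comment> \<open>Self-adjointness moves powers across the inner product, so distances between
    even powers are expressed by \<open>?g\<close> alone. As \<open>?g\<close> decreases to
    \<open>l\<close>, the terms \<open>?g (2 * m)\<close> and \<open>?g (2 * n)\<close> lie below
    \<open>l\<close> plus half the tolerance, while \<open>?g (m + n)\<close> is at least
    \<open>l\<close>.\<close>
  have Cauchy: "Cauchy (\<lambda>n. Q (2 * n) x)" for x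
  proof -
    let ?g = "\<lambda>n. (norm (Q n x))\<^sup>2"
    have "decseq ?g"
      by (rule decseq_SucI) (simp add: Q_Suc contr power_mono)
    then obtain l where l: "?g \<longlonglongrightarrow> l" "\<And>n. l \<le> ?g n"
      using decseq_convergent[of ?g 0] by auto
    have dist: "(norm (Q (2 * m) x - Q (2 * n) x))\<^sup>2 = ?g (2 * m) - 2 * ?g (m + n) + ?g (2 * n)" for m n
    proof -
      have "inner (Q (2 * m) x) (Q (2 * n) x) = inner (Q (m + n) x) (Q (m + n) x)"
      proof -
        have "inner (Q i x) (Q j x) = inner x (Q (i + j) x)" for i j
          by (simp add: Q_inner Q_add)
        moreover have "(m + n) + (m + n) = 2 * m + 2 * n"
          by simp
        ultimately show ?thesis
          by metis
      qed
      then show ?thesis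
        by (simp add: power2_norm_eq_inner inner_diff_left inner_diff_right inner_commute)
    qed
    show ?thesis
    proof (rule CauchyI)
      fix e :: real assume e: "0 < e"
      then obtain N where N: "\<And>n. n \<ge> N \<Longrightarrow> norm (?g n - l) < e\<^sup>2 / 2"
        using LIMSEQ_D[OF l(1), of "e\<^sup>2 / 2"] by auto
      have "norm (Q (2 * m) x - Q (2 * n) x) < e" if "m \<ge> N" "n \<ge> N" for m n
      proof -
        have "N \<le> 2 * m" "N \<le> 2 * n"
          using that by auto
        then have "?g (2 * m) - l < e\<^sup>2 / 2" "?g (2 * n) - l < e\<^sup>2 / 2"
          using N unfolding real_norm_def by (metis abs_less_iff)+
        then have "(norm (Q (2 * m) x - Q (2 * n) x))\<^sup>2 < e\<^sup>2"
          using l(2)[of "m + n"] unfolding dist by linarith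
        then show ?thesis
          using e by (simp add: power2_less_imp_less)
      qed
      then show "\<exists>M. \<forall>m\<ge>M. \<forall>n\<ge>M. norm (Q (2 * m) x - Q (2 * n) x) < e"
        by blast
    qed
  qed
  define p where "p x = lim (\<lambda>n. Q (2 * n) x)" for x
  have lim: "(\<lambda>n. Q (2 * n) x) \<longlonglongrightarrow> p x" for x
    unfolding p_def using Cauchy Cauchy_convergent convergent_LIMSEQ_iff by blast
  have "bounded_linear p"
  proof (rule bounded_linear_intro[where K = 1])
    fix x y and r :: real
    show "p (x + y) = p x + p y"
      using tendsto_add[OF lim lim, of x y] lim[of "x + y"] LIMSEQ_unique
      by (auto simp: blinfun.add_right)
    show "p (r *\<^sub>R x) = r *\<^sub>R p x"
      using tendsto_scaleR[OF tendsto_const lim, of r x] lim[of "r *\<^sub>R x"] LIMSEQ_unique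
      by (auto simp: blinfun.scaleR_right)
    show "norm (p x) \<le> norm x * 1"
      using LIMSEQ_le_const2[OF tendsto_norm[OF lim[of x]]] Q_norm by auto
  qed
  define P where "P = Blinfun p"
  have P: "blinfun_apply P = p"
    by (simp add: P_def bounded_linear_Blinfun_apply \<open>bounded_linear p\<close>)
  have TTP: "T (T (P x)) = P x" for x
  proof -
    have "(\<lambda>n. Q (2 * Suc n) x) \<longlonglongrightarrow> p x"
      using lim[of x] LIMSEQ_Suc by blast
    moreover have "(\<lambda>n. T (T (Q (2 * n) x))) \<longlonglongrightarrow> T (T (p x))"
      by (intro tendsto_intros lim)
    ultimately show ?thesis
      using LIMSEQ_unique by (auto simp: P Q_Suc)
  qed
  have fixed: "P x = x" if "T (T x) = x" for x
  proof -
    have "Q (2 * n) x = x" for n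
      by (induction n) (auto simp: Q_Suc that)
    then show ?thesis
      using lim[of x] by (simp add: P LIMSEQ_const_iff)
  qed
  have "cinner (P x) y = cinner x (P y)" for x y
  proof -
    have "(\<lambda>n. cinner (Q (2 * n) x) y) \<longlonglongrightarrow> cinner (P x) y"
      using tendsto_cinner_left lim P by metis
    moreover have "(\<lambda>n. cnj (cinner (Q (2 * n) y) x)) \<longlonglongrightarrow> cnj (cinner (P y) x)"
      using tendsto_cnj tendsto_cinner_left lim P by metis
    then have "(\<lambda>n. cinner (Q (2 * n) x) y) \<longlonglongrightarrow> cinner x (P y)"
      by (simp flip: cinner_commute add: Q_adj)
    ultimately show ?thesis
      using LIMSEQ_unique by blast
  qed
  moreover have "P o\<^sub>L P = P"
    by (rule blinfun_eqI) (simp add: fixed TTP)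
  ultimately have "projection P"
    by (simp add: projection_def is_adjoint_def)
  moreover have "P \<in> A"
    by (rule mem_strong_limit[of "\<lambda>n. Q (2 * n)"]) (auto simp: Q_mem P lim)
  ultimately show thesis
    using that[of P] fixed TTP by metis
qed

text \<open>After rescaling \<open>a\<close> to a contraction \<open>k\<close>, the operator
  \<open>T\<close> = 1 - k^2 preserves the norm of a vector only if \<open>k\<close> kills it. So
  the fixed points of the square of \<open>T\<close> form exactly the kernel of
  \<open>a\<close>.\<close>

lemma kernel_projection:
  assumes a: "a \<in> A" "is_adjoint a a"
  obtains P where "P \<in> A" "projection P" "\<And>x. P x = x \<longleftrightarrow> a x = 0"
proof -
  \<comment> \<open>For \<open>a = 0\<close> the quotient is 0 by convention, so
    \<open>k = 0\<close> and the resulting projection is the identity.\<close>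
  define k where "k = (1 / norm a) *\<^sub>R a"
  have k: "k \<in> A" "is_adjoint k k" "norm k \<le> 1"
    using a by (simp_all add: k_def mem_scaleR is_adjoint_scaleR)
  have k_eq_0: "k x = 0 \<longleftrightarrow> a x = 0" for x
    by (auto simp: k_def blinfun.scaleR_left)
  define T where "T = id_blinfun - (k o\<^sub>L k)"
  have T: "T \<in> A" "is_adjoint T T"
    by (simp_all add: T_def mem_diff mem_id mem_compose k is_adjoint_diff is_adjoint_id
        is_adjoint_compose)
  have T_apply: "T x = x - k (k x)" for x
    by (simp add: T_def blinfun.diff_left)
  have norm_T: "(norm (T x))\<^sup>2 \<le> (norm x)\<^sup>2 - (norm (k x))\<^sup>2" for x
    unfolding T_apply by (rule norm_diff_square_le) (use k in auto)
  have contr: "norm (T x) \<le> norm x" for x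
    by (rule power2_le_imp_le) (use norm_T[of x] zero_le_power2[of "norm (k x)"] in linarith, simp)
  have "T (T x) = x \<longleftrightarrow> k x = 0" for x
  proof
    assume "T (T x) = x"
    then have "(norm x)\<^sup>2 \<le> (norm (T x))\<^sup>2"
      using contr[of "T x"] by (simp add: power_mono)
    then have "(norm (k x))\<^sup>2 \<le> 0"
      using norm_T[of x] by linarith
    then show "k x = 0"
      by simp
  qed (simp add: T_apply)
  then show thesis
    using fixed_point_projection[OF T contr] that k_eq_0 by metis
qed

end

section \<open>The Lindelof property, common kernels, and primeness of factors\<close>

lemma separable_countable_subcover:
  assumes "separable TYPE('h :: complex_hilbert_space)"
    and op: "\<And>U. U \<in> F \<Longrightarrow> open (U :: 'h set)"
  obtains G where "countable G" "G \<subseteq> F" "\<Union>G = \<Union>F"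
proof -
  obtain D :: "'h set" where D: "countable D" "closure D = UNIV"
    using assms(1) by (auto simp: separable_def separable_space_def)
  \<comment> \<open>\<open>B\<close> indexes those balls of a countable base that fit into some
    member of \<open>F\<close>; \<open>u\<close> picks one such member for each of them.\<close>
  define B where "B = {(d, n). d \<in> D \<and> (\<exists>U\<in>F. ball d (1 / Suc n) \<subseteq> U)}"
  define u where "u = (\<lambda>(d, n). SOME U. U \<in> F \<and> ball d (1 / Suc n) \<subseteq> U)"
  have u: "u (d, n) \<in> F" "ball d (1 / Suc n) \<subseteq> u (d, n)" if "(d, n) \<in> B" for d n
  proof -
    have "\<exists>U. U \<in> F \<and> ball d (1 / Suc n) \<subseteq> U"
      using that by (auto simp: B_def)
    from someI_ex[OF this] show "u (d, n) \<in> F" "ball d (1 / Suc n) \<subseteq> u (d, n)"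
      by (auto simp: u_def)
  qed
  have "countable B"
    by (rule countable_subset[of _ "D \<times> UNIV"]) (auto simp: B_def D)
  moreover have "\<Union>(u ` B) = \<Union>F"
  proof
    show "\<Union>(u ` B) \<subseteq> \<Union>F"
      using u by fast
    show "\<Union>F \<subseteq> \<Union>(u ` B)"
    proof
      fix x assume "x \<in> \<Union>F"
      then obtain U e where U: "U \<in> F" "e > 0" "ball x e \<subseteq> U"
        using op open_contains_ball by blast
      obtain n where n: "1 / Suc n < e / 2"
        using nat_approx_posE[of "e / 2"] U(2) by auto
      obtain d where d: "d \<in> D" "dist d x < 1 / Suc n"
        using D(2) closure_approachable[of x D] by (metis UNIV_I of_nat_0_less_iff zero_less_Suc zero_less_divide_1_iff)
      have "ball d (1 / Suc n) \<subseteq> ball x e"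
      proof
        fix z assume "z \<in> ball d (1 / Suc n)"
        then have "dist d z < 1 / Suc n"
          by simp
        then have "dist x z < e"
          using d(2) n dist_triangle[of x z d] dist_commute[of d x] by linarith
        then show "z \<in> ball x e"
          by simp
      qed
      then have "(d, n) \<in> B"
        using d(1) U by (auto simp: B_def)
      moreover have "x \<in> ball d (1 / Suc n)"
        using d(2) by simp
      ultimately show "x \<in> \<Union>(u ` B)"
        using u(2) by blast
    qed
  qed
  moreover have "u ` B \<subseteq> F"
    using u(1) by auto
  ultimately show thesis
    using that[of "u ` B"] by auto
qed

context von_neumann
begin

text \<open>Take a convergent series of positive multiples of the operators \<open>\<tau>' n\<close>
  after \<open>\<tau> n\<close>. Its quadratic form at \<open>x\<close> is a weighted sum of the
  squared norms of \<open>\<tau> n x\<close>, which vanishes only if every term does.\<close>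

lemma weighted_sum_operator:
  assumes \<tau>: "\<And>n :: nat. \<tau> n \<in> A"
  obtains a where "a \<in> A" "is_adjoint a a" "\<And>x. a x = 0 \<longleftrightarrow> (\<forall>n. \<tau> n x = 0)"
proof -
  have "\<forall>n. \<exists>T\<in>A. is_adjoint (\<tau> n) T"
    using mem_adjoint \<tau> by blast
  then obtain \<tau>' where \<tau>': "\<And>n. \<tau>' n \<in> A" "\<And>n. is_adjoint (\<tau> n) (\<tau>' n)"
    by metis
  define c where "c n = \<tau>' n o\<^sub>L \<tau> n" for n
  \<comment> \<open>These weights make the series dominated by a geometric one; the summand 1 keeps
    the denominator positive when \<open>c n = 0\<close>.\<close>
  define w where "w n = (1 / 2) ^ n / (1 + norm (c n))" for n
  have w: "w n > 0" for n
    by (simp add: w_def add_pos_nonneg)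
  have "norm (w n *\<^sub>R c n) \<le> (1 / 2) ^ n" for n
  proof -
    have "norm (c n) \<le> 1 + norm (c n)" "0 < 1 + norm (c n)"
      by (simp_all add: add_pos_nonneg)
    then have "norm (c n) / (1 + norm (c n)) \<le> 1"
      by (simp add: divide_le_eq_1)
    then have "(1 / 2) ^ n * (norm (c n) / (1 + norm (c n))) \<le> (1 / 2) ^ n * 1"
      by (intro mult_left_mono) auto
    moreover have "norm (w n *\<^sub>R c n) = (1 / 2) ^ n * (norm (c n) / (1 + norm (c n)))"
      using w[of n] by (simp add: w_def)
    ultimately show ?thesis
      by simp
  qed
  then have summable: "summable (\<lambda>n. w n *\<^sub>R c n)"
    by (rule summable_comparison_test'[where g = "\<lambda>n. (1 / 2) ^ n" and N = 0, rotated]) auto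
  define a where "a = (\<Sum>n. w n *\<^sub>R c n)"
  have sums: "(\<lambda>n. w n *\<^sub>R c n) sums a"
    using summable by (simp add: a_def summable_sums)
  then have lim: "(\<lambda>n. \<Sum>i<n. w i *\<^sub>R c i) \<longlonglongrightarrow> a"
    by (simp add: sums_def)
  have "a \<in> A"
    by (rule mem_limit[OF lim]) (auto intro!: mem_sum mem_scaleR mem_compose \<tau> \<tau>' simp: c_def)
  moreover have "is_adjoint a a"
  proof (rule is_adjoint_limit[OF lim])
    fix n
    show "is_adjoint (\<Sum>i<n. w i *\<^sub>R c i) (\<Sum>i<n. w i *\<^sub>R c i)"
      by (induction n) (auto intro!: is_adjoint_add is_adjoint_scaleR is_adjoint_0
          is_adjoint_compose \<tau>' is_adjoint_sym[OF \<tau>'(2)] simp: c_def)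
  qed
  moreover have "a x = 0 \<longleftrightarrow> (\<forall>n. \<tau> n x = 0)" for x
  proof
    have sums_x: "(\<lambda>n. w n *\<^sub>R c n x) sums a x"
      using bounded_linear.sums[OF blinfun.bounded_linear_left sums, of x]
      by (simp add: blinfun.scaleR_left)
    show "\<forall>n. \<tau> n x = 0" if "a x = 0"
    proof -
      have "inner (c n x) x = (norm (\<tau> n x))\<^sup>2" for n
        using is_adjoint_inner[OF is_adjoint_sym[OF \<tau>'(2)]] by (simp add: c_def power2_norm_eq_inner)
      then have "(\<lambda>n. w n * (norm (\<tau> n x))\<^sup>2) sums 0"
        using bounded_linear.sums[OF bounded_linear_inner_left sums_x, of x] that by simp
      then have "w n * (norm (\<tau> n x))\<^sup>2 = 0" for n
        using suminf_eq_zero_iff[OF sums_summable, of "\<lambda>n. w n * (norm (\<tau> n x))\<^sup>2" 0] sums_unique[of _ 0]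
          less_imp_le[OF w] by auto
      moreover have "w n \<noteq> 0" for n
        using w[of n] by simp
      ultimately show ?thesis
        by simp
    qed
    show "a x = 0" if "\<forall>n. \<tau> n x = 0"
      using sums_x that sums_unique2[OF _ sums_zero] by (auto simp: c_def)
  qed
  ultimately show thesis
    using that by blast
qed

text \<open>Complements of kernels are open, so by the Lindelof property countably many members of
  \<open>S\<close> already have the same common kernel, and a weighted sum merges these into one
  operator.\<close>

lemma common_kernel_projection:
  assumes "separable TYPE('h)" and S: "S \<subseteq> A"
  obtains P where "P \<in> A" "projection P" "\<And>x. P x = x \<longleftrightarrow> (\<forall>t\<in>S. t x = 0)"
proof -
  define f where "f t = {x. blinfun_apply t x \<noteq> 0}" for t :: "'h \<Rightarrow>\<^sub>L 'h"
  have "open (f t)" for t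
    unfolding f_def by (intro open_Collect_neq continuous_intros)
  then obtain G where G: "countable G" "G \<subseteq> f ` S" "\<Union>G = \<Union>(f ` S)"
    using separable_countable_subcover[OF assms(1), of "f ` S"] by (metis (no_types) imageE)
  then obtain S0 where S0: "countable S0" "S0 \<subseteq> S" "G = f ` S0"
    using countable_subset_image by metis
  \<comment> \<open>Inserting 0 leaves the common kernel unchanged and makes the countable family
    nonempty, so that a sequence can enumerate it.\<close>
  have eq: "(\<forall>t\<in>S. t x = 0) \<longleftrightarrow> (\<forall>t\<in>insert 0 S0. t x = 0)" for x
    using G(3) unfolding S0(3) f_def by auto
  define \<tau> where "\<tau> = from_nat_into (insert 0 S0)"
  have range: "range \<tau> = insert 0 S0"
    unfolding \<tau>_def by (rule range_from_nat_into) (use S0 in auto)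
  have "\<tau> n \<in> A" for n
  proof -
    have "\<tau> n \<in> insert 0 S0"
      using range by blast
    then show ?thesis
      using S S0(2) mem_0 by auto
  qed
  then obtain a where a: "a \<in> A" "is_adjoint a a" "\<And>x. a x = 0 \<longleftrightarrow> (\<forall>n. \<tau> n x = 0)"
    using weighted_sum_operator[of \<tau>] by blast
  have "a x = 0 \<longleftrightarrow> (\<forall>t\<in>S. t x = 0)" for x
    unfolding eq a(3) range[symmetric] by blast
  then show thesis
    using kernel_projection[OF a(1,2)] that by metis
qed

lemma factor_prime:
  assumes "separable TYPE('h)" and cen: "center A = range (\<lambda>c. scaleC_op c id_blinfun)"
    and xy: "x \<in> A" "y \<in> A" and zero: "\<And>u. u \<in> A \<Longrightarrow> y o\<^sub>L u o\<^sub>L x = 0"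
  shows "x = 0 \<or> y = 0"
proof -
  have "(\<lambda>u. y o\<^sub>L u) ` A \<subseteq> A"
    using xy(2) mem_compose by blast
  from common_kernel_projection[OF assms(1) this] obtain P where P: "P \<in> A" "projection P"
      and "\<And>v. P v = v \<longleftrightarrow> (\<forall>t\<in>(\<lambda>u. y o\<^sub>L u) ` A. t v = 0)"
    by metis
  then have fixed: "P v = v \<longleftrightarrow> (\<forall>u\<in>A. y (u v) = 0)" for v
    by simp
  have PuP: "P (u (P v)) = u (P v)" if "u \<in> A" for u v
  proof -
    have "y (w (u (P v))) = 0" if "w \<in> A" for w
    proof -
      have "y ((w o\<^sub>L u) (P v)) = 0"
        using projection_apply[OF P(2), of v] fixed[of "P v"] mem_compose[OF that \<open>u \<in> A\<close>] by blast
      then show ?thesis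
        by simp
    qed
    then show ?thesis
      by (simp add: fixed)
  qed
  have "P o\<^sub>L u = u o\<^sub>L P" if u: "u \<in> A" for u
  proof -
    obtain u' where u': "u' \<in> A" "is_adjoint u u'"
      using mem_adjoint u by blast
    have P_adj: "is_adjoint P P"
      using P(2) by (simp add: projection_def)
    \<comment> \<open>Invariance of the range of \<open>P\<close> under the adjoint
      \<open>u'\<close> becomes, after taking adjoints, invariance of the kernel of \<open>P\<close>
      under \<open>u\<close>. Together with invariance of the range this gives commutation.\<close>
    have "P o\<^sub>L (u' o\<^sub>L P) = u' o\<^sub>L P"
      by (rule blinfun_eqI) (simp add: PuP u')
    moreover have "is_adjoint (P o\<^sub>L (u' o\<^sub>L P)) ((P o\<^sub>L u) o\<^sub>L P)" "is_adjoint (u' o\<^sub>L P) (P o\<^sub>L u)"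
      using is_adjoint_compose P_adj is_adjoint_sym[OF u'(2)] by blast+
    ultimately have "(P o\<^sub>L u) o\<^sub>L P = P o\<^sub>L u"
      using is_adjoint_unique by metis
    then show ?thesis
      using PuP[OF u] by (metis (no_types, lifting) blinfun_apply_blinfun_compose blinfun_eqI)
  qed
  then have "P \<in> center A"
    using P(1) by (simp add: center_def)
  then obtain c where "P = scaleC_op c id_blinfun"
    using cen by auto
  then have Pc: "P v = c *\<^sub>C v" for v
    by (simp add: scaleC_op.rep_eq)
  \<comment> \<open>If \<open>c = 1\<close>, every vector is fixed, and choosing \<open>u\<close> as
    the identity gives \<open>y = 0\<close>. Otherwise \<open>P\<close> fixes only 0, while
    \<open>zero\<close> says that it fixes the range of \<open>x\<close>.\<close>
  show ?thesis
  proof (cases "c = 1")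
    case True
    then have "y v = 0" for v
      using fixed[of v] mem_id Pc by auto
    then show ?thesis
      by (auto intro: blinfun_eqI)
  next
    case False
    have "v = 0" if "P v = v" for v
      using that False Pc[of v] complex_vector.scale_cancel_right[of c v 1] by simp
    moreover have "P (x v) = x v" for v
      using zero fixed by (metis blinfun.zero_left blinfun_apply_blinfun_compose)
    ultimately show ?thesis
      by (auto intro: blinfun_eqI)
  qed
qed

section \<open>Square roots\<close>

text \<open>The operator \<open>s\<close> is the absolute value of \<open>k\<close>, obtained as 1 -
  Y where \<open>Y\<close> is the limit of an iteration in 1 - k^2. The iterates are polynomials in
  k^2, so whatever commutes with \<open>k\<close> commutes with \<open>s\<close>.\<close>

lemma sqrt_of_square_contraction:
  assumes k: "k \<in> A" "is_adjoint k k" "norm k \<le> 1"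
  obtains s where "s \<in> A" "is_adjoint s s" "s o\<^sub>L s = k o\<^sub>L k" "\<And>v. 0 \<le> inner (s v) v"
    "\<And>c. c o\<^sub>L k = k o\<^sub>L c \<Longrightarrow> c o\<^sub>L s = s o\<^sub>L c"
proof -
  define x where "x = id_blinfun - (k o\<^sub>L k)"
  have x_apply: "x v = v - k (k v)" for v
    by (simp add: x_def blinfun.diff_left)
  have x: "x \<in> A" "is_adjoint x x"
    by (simp_all add: x_def k mem_diff mem_id mem_compose is_adjoint_diff is_adjoint_id
        is_adjoint_compose)
  have norm_x: "norm x \<le> 1"
  proof (rule norm_blinfun_bound)
    fix v
    have "(norm (x v))\<^sup>2 \<le> (norm v)\<^sup>2"
      using norm_diff_square_le[OF k(2,3), of v] zero_le_power2[of "norm (k v)"]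
      unfolding x_apply by linarith
    then show "norm (x v) \<le> 1 * norm v"
      using power2_le_imp_le by auto
  qed simp
  \<comment> \<open>The iterates increase to \<open>1 - sqrt (1 - x)\<close>; at \<open>x = 1\<close> they give the scalar majorant \<open>c\<close>.\<close>
  define y where "y = rec_nat 0 (\<lambda>_ z. (1 / 2) *\<^sub>R (x + (z o\<^sub>L z)))"
  have y_0: "y 0 = 0" and y_Suc: "y (Suc n) = (1 / 2) *\<^sub>R (x + (y n o\<^sub>L y n))" for n
    by (simp_all add: y_def)
  define c :: "nat \<Rightarrow> real" where "c = rec_nat 0 (\<lambda>_ z. (1 + z\<^sup>2) / 2)"
  have c_0: "c 0 = 0" and c_Suc: "c (Suc n) = (1 + (c n)\<^sup>2) / 2" for n
    by (simp_all add: c_def)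
  have c_bounds: "0 \<le> c n \<and> c n \<le> 1" for n
    by (induction n) (auto simp: c_0 c_Suc power_le_one)
  have c_mono: "c n \<le> c (Suc n)" for n
    using zero_le_power2[of "1 - c n"] by (simp add: c_Suc power2_eq_square algebra_simps)
  have norm_y: "norm (y n) \<le> c n" for n
  proof (induction n)
    case (Suc n)
    have "norm (y n o\<^sub>L y n) \<le> (c n)\<^sup>2"
      using norm_blinfun_compose[of "y n" "y n"] mult_mono[OF Suc Suc] c_bounds[of n]
      by (simp add: power2_eq_square)
    then show ?case
      using norm_triangle_ineq[of x "y n o\<^sub>L y n"] norm_x by (simp add: y_Suc c_Suc)
  qed (simp add: y_0 c_0)
  \<comment> \<open>The difference of two squares is split as y' d + d y, without assuming that the
    factors commute. Its norm is then bounded by the same expression in the scalars, where it equals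
    a difference of squares.\<close>
  have norm_step: "norm (y (Suc n) - y n) \<le> c (Suc n) - c n" for n
  proof (induction n)
    case 0
    then show ?case
      using norm_y[of "Suc 0"] by (simp add: y_0 c_0)
  next
    case (Suc n)
    let ?d = "y (Suc n) - y n"
    have "norm (y (Suc n) o\<^sub>L ?d) \<le> c (Suc n) * (c (Suc n) - c n)"
      using norm_blinfun_compose[of "y (Suc n)" ?d] mult_mono[OF norm_y[of "Suc n"] Suc] c_bounds[of "Suc n"]
      by simp
    moreover have "norm (?d o\<^sub>L y n) \<le> (c (Suc n) - c n) * c n"
      using norm_blinfun_compose[of ?d "y n"] mult_mono[OF Suc norm_y[of n]] c_mono[of n]
      by simp
    moreover have "y (Suc (Suc n)) - y (Suc n) = (1 / 2) *\<^sub>R ((y (Suc n) o\<^sub>L ?d) + (?d o\<^sub>L y n))"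
    proof -
      have "y (Suc (Suc n)) - y (Suc n) =
          (1 / 2) *\<^sub>R (x + (y (Suc n) o\<^sub>L y (Suc n))) - (1 / 2) *\<^sub>R (x + (y n o\<^sub>L y n))"
        by (simp add: y_Suc)
      also have "\<dots> = (1 / 2) *\<^sub>R ((y (Suc n) o\<^sub>L ?d) + (?d o\<^sub>L y n))"
        by (rule blinfun_eqI) (simp add: blinfun.bilinear_simps algebra_simps)
      finally show ?thesis .
    qed
    ultimately have "norm (y (Suc (Suc n)) - y (Suc n)) \<le>
        (c (Suc n) * (c (Suc n) - c n) + (c (Suc n) - c n) * c n) / 2"
      using norm_triangle_ineq[of "y (Suc n) o\<^sub>L ?d" "?d o\<^sub>L y n"] by simp
    also have "\<dots> = c (Suc (Suc n)) - c (Suc n)"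
    proof -
      have *: "c (Suc n) * (c (Suc n) - c n) + (c (Suc n) - c n) * c n = (c (Suc n))\<^sup>2 - (c n)\<^sup>2"
        by (simp add: power2_eq_square algebra_simps)
      show ?thesis
        unfolding * using c_Suc[of "Suc n"] c_Suc[of n] by argo
    qed
    finally show ?case .
  qed
  \<comment> \<open>The scalar sequence is monotone and bounded, so its increments are summable;
    they dominate those of \<open>y\<close>, which therefore converges in norm.\<close>
  have "incseq c" "\<forall>n. c n \<le> 1"
    using c_mono c_bounds by (auto intro: incseq_SucI)
  then obtain l where "c \<longlonglongrightarrow> l"
    using incseq_convergent by blast
  then have "summable (\<lambda>n. c (Suc n) - c n)"
    using telescope_summable by blast
  then have "summable (\<lambda>n. y (Suc n) - y n)"
    by (rule summable_comparison_test'[where N = 0]) (rule norm_step)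
  then have "(\<lambda>n. \<Sum>i<n. y (Suc i) - y i) \<longlonglongrightarrow> (\<Sum>n. y (Suc n) - y n)"
    by (rule summable_LIMSEQ)
  then obtain Y where Y: "y \<longlonglongrightarrow> Y"
    by (auto simp: sum_lessThan_telescope y_0)
  have compose_lim: "(\<lambda>n. S n o\<^sub>L T n) \<longlonglongrightarrow> (s o\<^sub>L t)" if "S \<longlonglongrightarrow> s" "T \<longlonglongrightarrow> t"
    for S T and s t :: "'h \<Rightarrow>\<^sub>L 'h"
    using bounded_bilinear.tendsto[OF bounded_bilinear_blinfun_compose that] .
  have "(\<lambda>n. y (Suc n)) \<longlonglongrightarrow> (1 / 2) *\<^sub>R (x + (Y o\<^sub>L Y))"
    unfolding y_Suc by (intro tendsto_intros compose_lim Y)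
  then have Y_eq: "Y = (1 / 2) *\<^sub>R (x + (Y o\<^sub>L Y))"
    using LIMSEQ_Suc[OF Y] LIMSEQ_unique by blast
  have y: "y n \<in> A \<and> is_adjoint (y n) (y n)" for n
    by (induction n) (auto simp: y_0 y_Suc mem_0 is_adjoint_0 x mem_scaleR mem_add mem_compose
        is_adjoint_add is_adjoint_scaleR is_adjoint_compose)
  have "norm Y \<le> 1"
    using LIMSEQ_le_const2[OF tendsto_norm[OF Y]] norm_y c_bounds order_trans by blast
  show thesis
  proof (rule that[of "id_blinfun - Y"])
    show "id_blinfun - Y \<in> A" "is_adjoint (id_blinfun - Y) (id_blinfun - Y)"
      using mem_limit[OF Y] is_adjoint_limit[OF Y] y
      by (auto intro!: mem_diff mem_id is_adjoint_diff is_adjoint_id)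
    show "(id_blinfun - Y) o\<^sub>L (id_blinfun - Y) = k o\<^sub>L k"
    proof (rule blinfun_eqI)
      fix v
      have "Y v = (1 / 2) *\<^sub>R (x v + Y (Y v))"
        using arg_cong[OF Y_eq, of "\<lambda>T. blinfun_apply T v"] by (simp add: blinfun.bilinear_simps)
      then have "Y v + Y v = x v + Y (Y v)"
        by (metis field_sum_of_halves mult_1 scaleR_half_double scaleR_add_right)
      then show "((id_blinfun - Y) o\<^sub>L (id_blinfun - Y)) v = (k o\<^sub>L k) v"
        by (simp add: x_apply blinfun.bilinear_simps algebra_simps)
    qed
    show "0 \<le> inner ((id_blinfun - Y) v) v" for v
    proof -
      have "inner (Y v) v \<le> norm (Y v) * norm v"
        by (rule norm_cauchy_schwarz)
      also have "norm (Y v) \<le> 1 * norm v"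
        using norm_blinfun[of Y v] mult_right_mono[OF \<open>norm Y \<le> 1\<close> norm_ge_zero[of v]] by linarith
      finally show ?thesis
        by (simp add: blinfun.diff_left inner_diff_left power2_norm_eq_inner[symmetric] power2_eq_square
            mult_right_mono)
    qed
    show "d o\<^sub>L (id_blinfun - Y) = (id_blinfun - Y) o\<^sub>L d" if "d o\<^sub>L k = k o\<^sub>L d" for d
    proof -
      have dk: "d (k v) = k (d v)" for v
        by (metis blinfun_apply_blinfun_compose that)
      have "d (y n v) = y n (d v)" for n v
        by (induction n arbitrary: v) (auto simp: y_0 y_Suc x_apply dk blinfun.bilinear_simps)
      then have "d o\<^sub>L y n = y n o\<^sub>L d" for n
        by (auto intro: blinfun_eqI)
      then have "(\<lambda>n. y n o\<^sub>L d) \<longlonglongrightarrow> (d o\<^sub>L Y)"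
        using compose_lim[OF tendsto_const[of d] Y] by simp
      then have "d o\<^sub>L Y = Y o\<^sub>L d"
        using compose_lim[OF Y tendsto_const[of d]] LIMSEQ_unique by blast
      then have "d (Y v) = Y (d v)" for v
        by (metis blinfun_apply_blinfun_compose)
      then show ?thesis
        by (auto intro!: blinfun_eqI simp: blinfun.bilinear_simps)
    qed
  qed
qed

lemma sqrt_of_square:
  assumes k: "k \<in> A" "is_adjoint k k"
  obtains s where "s \<in> A" "is_adjoint s s" "s o\<^sub>L s = k o\<^sub>L k" "\<And>v. 0 \<le> inner (s v) v"
    "\<And>c. c o\<^sub>L k = k o\<^sub>L c \<Longrightarrow> c o\<^sub>L s = s o\<^sub>L c"
proof -
  define h where "h = (1 / norm k) *\<^sub>R k"
  have h: "h \<in> A" "is_adjoint h h" "norm h \<le> 1" and k_eq: "k = norm k *\<^sub>R h"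
    using k by (simp_all add: h_def mem_scaleR is_adjoint_scaleR)
  obtain s where s: "s \<in> A" "is_adjoint s s" "s o\<^sub>L s = h o\<^sub>L h" "\<And>v. 0 \<le> inner (s v) v"
    "\<And>c. c o\<^sub>L h = h o\<^sub>L c \<Longrightarrow> c o\<^sub>L s = s o\<^sub>L c"
    using sqrt_of_square_contraction[OF h] by metis
  have scaleR_compose: "(r *\<^sub>R S) o\<^sub>L T = r *\<^sub>R (S o\<^sub>L T)" "S o\<^sub>L (r *\<^sub>R T) = r *\<^sub>R (S o\<^sub>L T)"
    for r and S T :: "'h \<Rightarrow>\<^sub>L 'h"
    by (auto intro!: blinfun_eqI simp: blinfun.bilinear_simps)
  show thesis
  proof (rule that[of "norm k *\<^sub>R s"])
    show "(norm k *\<^sub>R s) o\<^sub>L (norm k *\<^sub>R s) = k o\<^sub>L k"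
      by (subst (3 4) k_eq) (simp add: scaleR_compose s(3))
    show "c o\<^sub>L (norm k *\<^sub>R s) = (norm k *\<^sub>R s) o\<^sub>L c" if "c o\<^sub>L k = k o\<^sub>L c" for c
      using s(5)[of c] that by (simp add: h_def scaleR_compose)
  qed (use s(1,2,4) in \<open>simp_all add: mem_scaleR is_adjoint_scaleR blinfun.scaleR_left\<close>)
qed

end

section \<open>Corners of a von Neumann algebra\<close>

context von_neumann
begin

text \<open>Up to a factor 2, \<open>u\<close> and \<open>v\<close> are the positive and negative
  parts of \<open>h - c *\<^sub>R r\<close>, built from its absolute value. The cut \<open>c\<close>
  lies strictly between two values of the quadratic form of \<open>h\<close> on unit vectors in the
  range of \<open>r\<close>, which makes both parts nonzero. The commutation clause allows the split
  operator to be moved past \<open>u\<close>.\<close>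

lemma spectral_split:
  assumes r: "r \<in> A" "projection r" and h: "h \<in> A" "is_adjoint h h" "r o\<^sub>L h = h"
    and nonscalar: "\<And>c :: real. h \<noteq> c *\<^sub>R r"
  obtains u v where "u \<in> A" "v \<in> A" "is_adjoint u u" "is_adjoint v v" "u \<noteq> 0" "v \<noteq> 0"
    "r o\<^sub>L u = u" "r o\<^sub>L v = v" "u o\<^sub>L v = 0"
    "\<And>d. d o\<^sub>L h = h o\<^sub>L d \<Longrightarrow> d o\<^sub>L r = r o\<^sub>L d \<Longrightarrow> d o\<^sub>L u = u o\<^sub>L d"
proof -
  have r_adj: "is_adjoint r r"
    using r(2) by (simp add: projection_def)
  have rr: "r (r w) = r w" for w
    using r(2) by (rule projection_apply)
  have rh: "r (h w) = h w" for w
    by (metis blinfun_apply_blinfun_compose h(3))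
  have "h o\<^sub>L r = h"
    using is_adjoint_unique[OF is_adjoint_compose[OF r_adj h(2)]] h(2,3) by simp
  then have hr: "h (r w) = h w" for w
    by (metis blinfun_apply_blinfun_compose)
  have "r \<noteq> 0"
    using nonscalar[of 0] h(3) by auto
  then obtain z where z: "r z \<noteq> 0"
    by (metis blinfun_eqI zero_blinfun.rep_eq)
  define x0 where "x0 = (1 / norm (r z)) *\<^sub>R r z"
  have x0: "r x0 = x0" "inner x0 x0 = 1"
    using z by (simp_all add: x0_def blinfun.scaleR_right rr flip: power2_norm_eq_inner)
  define c0 where "c0 = inner (h x0) x0"
  \<comment> \<open>A self-adjoint nonzero \<open>D\<close> has a nonzero value of its quadratic
    form, which yields a vector \<open>y0\<close> whose Rayleigh quotient \<open>d\<close> differs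
    from \<open>c0\<close>.\<close>
  define D where "D = h - c0 *\<^sub>R r"
  have "is_adjoint D D"
    by (simp add: D_def h r_adj is_adjoint_diff is_adjoint_scaleR)
  moreover have "D \<noteq> 0"
    using nonscalar[of c0] by (simp add: D_def)
  ultimately obtain z' where z': "inner (D z') z' \<noteq> 0"
    using self_adjoint_inner_eq_0 by blast
  define y0 where "y0 = r z'"
  have y0: "r y0 = y0"
    by (simp add: y0_def rr)
  have "inner (D z') z' = inner (D y0) y0"
  proof -
    have "r (D z') = D z'" "D y0 = D z'"
      by (simp_all add: D_def y0_def blinfun.bilinear_simps rh hr rr)
    then show ?thesis
      using is_adjoint_inner[OF r_adj, of "D z'" z'] by (simp add: y0_def)
  qed
  then have Dy0: "inner (D y0) y0 \<noteq> 0"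
    using z' by simp
  then have "y0 \<noteq> 0"
    by auto
  then have n: "0 < inner y0 y0"
    by simp
  define d where "d = inner (h y0) y0 / inner y0 y0"
  have d: "inner (h y0) y0 = d * inner y0 y0"
    using n by (simp add: d_def)
  have "d \<noteq> c0"
    using Dy0 d by (auto simp: D_def y0 blinfun.bilinear_simps inner_diff_left)
  define c where "c = (c0 + d) / 2"
  have "\<exists>x y. r x = x \<and> r y = y \<and> inner (h x) x < c * inner x x \<and> c * inner y y < inner (h y) y"
  proof (cases "c0 < d")
    case True
    then have "inner (h x0) x0 < c * inner x0 x0" "c * inner y0 y0 < inner (h y0) y0"
      using n x0 by (auto simp: c_def d c0_def)
    then show ?thesis
      using x0 y0 by blast
  next
    case False
    then have "inner (h y0) y0 < c * inner y0 y0" "c * inner x0 x0 < inner (h x0) x0"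
      using n x0 \<open>d \<noteq> c0\<close> by (auto simp: c_def d c0_def)
    then show ?thesis
      using x0 y0 by blast
  qed
  then obtain x y where x: "r x = x" "inner (h x) x < c * inner x x"
    and y: "r y = y" "c * inner y y < inner (h y) y"
    by blast
  define k where "k = h - c *\<^sub>R r"
  have k: "k \<in> A" "is_adjoint k k"
    by (simp_all add: k_def h r r_adj mem_diff mem_scaleR is_adjoint_diff is_adjoint_scaleR)
  have rk: "r (k w) = k w" and kr: "k (r w) = k w" for w
    by (simp_all add: k_def blinfun.bilinear_simps rh hr rr)
  obtain s where s: "s \<in> A" "is_adjoint s s" "s o\<^sub>L s = k o\<^sub>L k" and s_pos: "\<And>w. 0 \<le> inner (s w) w"
    and s_comm: "\<And>d. d o\<^sub>L k = k o\<^sub>L d \<Longrightarrow> d o\<^sub>L s = s o\<^sub>L d"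
    using sqrt_of_square[OF k] by metis
  have "r o\<^sub>L k = k o\<^sub>L r"
    by (rule blinfun_eqI) (simp add: rk kr)
  then have "r o\<^sub>L s = s o\<^sub>L r" "k o\<^sub>L s = s o\<^sub>L k"
    using s_comm by blast+
  then have rs: "r (s w) = s (r w)" and ks: "k (s w) = s (k w)" and ss: "s (s w) = k (k w)" for w
    using s(3) by (metis blinfun_apply_blinfun_compose)+
  define u where "u = r o\<^sub>L (s + k)"
  define v where "v = r o\<^sub>L (s - k)"
  have u_eq: "u = (s + k) o\<^sub>L r" and v_eq: "v = (s - k) o\<^sub>L r"
    by (auto intro!: blinfun_eqI simp: u_def v_def blinfun.bilinear_simps rs rk kr)
  have u_apply: "u w = s (r w) + k (r w)" and v_apply: "v w = s (r w) - k (r w)" for w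
    by (simp_all add: u_eq v_eq blinfun.bilinear_simps)
  show thesis
  proof (rule that[of u v])
    show "u \<in> A" "v \<in> A"
      by (simp_all add: u_def v_def r s k mem_compose mem_add mem_diff)
    show "is_adjoint u u"
      using is_adjoint_compose[OF r_adj is_adjoint_add[OF s(2) k(2)]] u_eq u_def by simp
    show "is_adjoint v v"
      using is_adjoint_compose[OF r_adj is_adjoint_diff[OF s(2) k(2)]] v_eq v_def by simp
    show "u \<noteq> 0"
    proof
      assume "u = 0"
      then have "s y + k y = 0"
        using u_apply[of y] by (simp add: y(1))
      then have "inner (s y) y + inner (k y) y = 0"
        by (simp flip: inner_add_left)
      moreover have "0 < inner (k y) y"
        using y by (simp add: k_def blinfun.bilinear_simps inner_diff_left)
      ultimately show False
        using s_pos[of y] by linarith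
    qed
    show "v \<noteq> 0"
    proof
      assume "v = 0"
      then have "s x - k x = 0"
        using v_apply[of x] by (simp add: x(1))
      then have "inner (s x) x - inner (k x) x = 0"
        by (simp flip: inner_diff_left)
      moreover have "inner (k x) x < 0"
        using x by (simp add: k_def blinfun.bilinear_simps inner_diff_left)
      ultimately show False
        using s_pos[of x] by linarith
    qed
    show "r o\<^sub>L u = u" "r o\<^sub>L v = v"
      by (auto intro!: blinfun_eqI simp: u_def v_def rr)
    \<comment> \<open>This is (s + k)(s - k) = s^2 - k^2 = 0, valid because \<open>s\<close> and
      \<open>k\<close> commute.\<close>
    show "u o\<^sub>L v = 0"
      by (auto intro!: blinfun_eqI simp: u_eq v_eq blinfun.bilinear_simps rs rk kr rr ks ss)
    show "d o\<^sub>L u = u o\<^sub>L d" if "d o\<^sub>L h = h o\<^sub>L d" "d o\<^sub>L r = r o\<^sub>L d" for d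
    proof -
      have dh: "d (h w) = h (d w)" and dr: "d (r w) = r (d w)" for w
        using that by (metis blinfun_apply_blinfun_compose)+
      have dk: "d (k w) = k (d w)" for w
        by (simp add: k_def dh dr blinfun.bilinear_simps)
      then have "d o\<^sub>L s = s o\<^sub>L d"
        by (intro s_comm) (auto intro!: blinfun_eqI)
      then have "d (s w) = s (d w)" for w
        by (metis blinfun_apply_blinfun_compose)
      then show ?thesis
        by (auto intro!: blinfun_eqI simp: u_def dr dk blinfun.bilinear_simps)
    qed
  qed
qed

text \<open>Since \<open>u\<close> and \<open>v\<close> live in the corner, \<open>e\<close> between
  them may be replaced by its compression \<open>t\<close>. If \<open>t\<close> is a multiple of
  \<open>r\<close>, any orthogonal pair from \<open>h\<close> works; otherwise \<open>t\<close>
  itself is split, and it can be moved past \<open>u\<close> to meet the zero product of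
  \<open>u\<close> and \<open>v\<close>.\<close>

lemma corner_orthogonal_through:
  assumes r: "r \<in> A" "projection r" and e: "e \<in> A" "is_adjoint e e"
    and h: "h \<in> A" "is_adjoint h h" "r o\<^sub>L h = h" and nonscalar: "\<And>c :: real. h \<noteq> c *\<^sub>R r"
  obtains u v where "u \<in> A" "v \<in> A" "is_adjoint u u" "is_adjoint v v" "u \<noteq> 0" "v \<noteq> 0"
    "r o\<^sub>L u = u" "r o\<^sub>L v = v" "u o\<^sub>L e o\<^sub>L v = 0"
proof -
  have r_adj: "is_adjoint r r"
    using r(2) by (simp add: projection_def)
  have rr: "r (r w) = r w" for w
    using r(2) by (rule projection_apply)
  define t where "t = r o\<^sub>L (e o\<^sub>L r)"
  have t_apply: "t w = r (e (r w))" for w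
    by (simp add: t_def)
  have t: "t \<in> A" "is_adjoint t t" "r o\<^sub>L t = t"
    using is_adjoint_compose[OF r_adj is_adjoint_compose[OF e(2) r_adj]]
    by (auto intro!: mem_compose r e blinfun_eqI simp: t_def rr blinfun_compose_assoc)
  have ueu: "u o\<^sub>L e o\<^sub>L v = 0"
    if u: "is_adjoint u u" "r o\<^sub>L u = u" and v: "r o\<^sub>L v = v" and utv: "\<And>w. u (t (v w)) = 0" for u v
  proof (rule blinfun_eqI)
    fix w
    have "u o\<^sub>L r = u"
      using is_adjoint_unique[OF is_adjoint_compose[OF r_adj u(1)]] u by simp
    then have "u (r w) = u w" for w
      by (metis blinfun_apply_blinfun_compose)
    moreover have "r (v w) = v w"
      by (metis blinfun_apply_blinfun_compose v)
    ultimately show "(u o\<^sub>L e o\<^sub>L v) w = blinfun_apply 0 w"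
      using utv[of w] by (simp add: t_apply)
  qed
  show thesis
  proof (cases "\<exists>c :: real. t = c *\<^sub>R r")
    case True
    then obtain c where c: "t = c *\<^sub>R r"
      by blast
    obtain u v where uv: "u \<in> A" "v \<in> A" "is_adjoint u u" "is_adjoint v v" "u \<noteq> 0" "v \<noteq> 0"
      "r o\<^sub>L u = u" "r o\<^sub>L v = v" "u o\<^sub>L v = 0"
      using spectral_split[OF r h nonscalar] by metis
    have "r (v w) = v w" "u (v w) = 0" for w
      by (metis blinfun_apply_blinfun_compose uv(8)) (metis blinfun_apply_blinfun_compose uv(9) zero_blinfun.rep_eq)
    then have "u (t (v w)) = 0" for w
      by (simp add: c blinfun.bilinear_simps)
    then show thesis
      using that ueu uv by metis
  next
    case False
    then obtain u v where uv: "u \<in> A" "v \<in> A" "is_adjoint u u" "is_adjoint v v" "u \<noteq> 0" "v \<noteq> 0"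
      "r o\<^sub>L u = u" "r o\<^sub>L v = v" "u o\<^sub>L v = 0"
      and comm: "\<And>d. d o\<^sub>L t = t o\<^sub>L d \<Longrightarrow> d o\<^sub>L r = r o\<^sub>L d \<Longrightarrow> d o\<^sub>L u = u o\<^sub>L d"
      using spectral_split[OF r t] by metis
    have "t o\<^sub>L u = u o\<^sub>L t"
      by (rule comm) (auto intro!: blinfun_eqI simp: t_apply rr)
    then have "u (t (v w)) = t (u (v w))" for w
      by (metis blinfun_apply_blinfun_compose)
    moreover have "u (v w) = 0" for w
      by (metis blinfun_apply_blinfun_compose uv(9) zero_blinfun.rep_eq)
    ultimately have "u (t (v w)) = 0" for w
      by (simp add: blinfun.bilinear_simps)
    then show thesis
      using that ueu uv by metis
  qed
qed

section \<open>Corners of minimal projections\<close>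

lemma bounded_scaleC: "S \<in> A \<Longrightarrow> S (c *\<^sub>C x) = c *\<^sub>C S x"
  using mem_bounded by (auto simp: bounded_operators_def)

text \<open>Minimality is stated for self-adjoint elements with real multiples; splitting
  \<open>x\<close> into its self-adjoint and skew parts extends it to all of \<open>A\<close> with
  complex multiples.\<close>

lemma minimal_corner_scalar:
  assumes r: "r \<in> A" "projection r"
    and min: "\<forall>h\<in>A. is_adjoint h h \<longrightarrow> r o\<^sub>L h = h \<longrightarrow> (\<exists>c :: real. h = c *\<^sub>R r)"
    and x: "x \<in> A"
  shows "\<exists>c. \<forall>v. r (x (r v)) = c *\<^sub>C r v"
proof -
  have r_adj: "is_adjoint r r"
    using r(2) by (simp add: projection_def)
  have self_adjoint: "\<exists>c :: real. \<forall>v. r (y (r v)) = c *\<^sub>R r v" if y: "y \<in> A" "is_adjoint y y" for y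
  proof -
    have "is_adjoint (r o\<^sub>L (y o\<^sub>L r)) (r o\<^sub>L (y o\<^sub>L r))"
      using is_adjoint_compose[OF r_adj is_adjoint_compose[OF y(2) r_adj]]
      by (simp add: blinfun_compose_assoc)
    moreover have "r o\<^sub>L (r o\<^sub>L (y o\<^sub>L r)) = r o\<^sub>L (y o\<^sub>L r)"
      by (auto intro!: blinfun_eqI simp: projection_apply[OF r(2)])
    ultimately obtain c :: real where "r o\<^sub>L (y o\<^sub>L r) = c *\<^sub>R r"
      using min r(1) y(1) mem_compose by blast
    then have "r (y (r v)) = c *\<^sub>R r v" for v
      by (metis blinfun.scaleR_left blinfun_apply_blinfun_compose)
    then show ?thesis
      by blast
  qed
  obtain x' where x': "x' \<in> A" "is_adjoint x x'"
    using mem_adjoint x by blast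
  define y where "y = x + x'"
  define z where "z = scaleC_op \<i> (x - x')"
  have "y \<in> A" "is_adjoint y y"
    using is_adjoint_add[OF x'(2) is_adjoint_sym[OF x'(2)]]
    by (auto simp: y_def mem_add x x' add.commute)
  then obtain c where c: "\<And>v. r (y (r v)) = c *\<^sub>R r v"
    using self_adjoint by blast
  have "z \<in> A"
    by (simp add: z_def mem_scaleC mem_diff x x')
  moreover have "is_adjoint z z"
    using x'(2) is_adjoint_sym[OF x'(2)]
    by (auto simp: z_def is_adjoint_def scaleC_op.rep_eq blinfun.diff_left cinner_scaleC_left
        cinner_scaleC_right cinner_diff_left cinner_diff_right algebra_simps)
  ultimately obtain d where d: "\<And>v. r (z (r v)) = d *\<^sub>R r v"
    using self_adjoint by blast
  \<comment> \<open>The coefficient comes from \<open>x\<close> = (y - i z) / 2.\<close>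
  have "r (x (r v)) = ((of_real c - \<i> * of_real d) / 2) *\<^sub>C r v" for v
  proof -
    let ?X = "r (x (r v))" and ?X' = "r (x' (r v))"
    have "?X + ?X' = of_real c *\<^sub>C r v"
      using c[of v] by (simp add: y_def blinfun.bilinear_simps scaleC_of_real)
    moreover have "\<i> *\<^sub>C (?X - ?X') = of_real d *\<^sub>C r v"
      using d[of v] bounded_scaleC[OF r(1), of \<i>]
      by (simp add: z_def scaleC_op.rep_eq blinfun.bilinear_simps scaleC_of_real)
    then have "(- \<i>) *\<^sub>C \<i> *\<^sub>C (?X - ?X') = (- \<i>) *\<^sub>C of_real d *\<^sub>C r v"
      by simp
    then have "?X - ?X' = (- \<i> * of_real d) *\<^sub>C r v"
      by (simp add: scaleC_scaleC)
    ultimately have "?X + ?X = (of_real c - \<i> * of_real d) *\<^sub>C r v"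
      by (simp add: complex_vector.scale_left_diff_distrib algebra_simps)
    moreover have "?X = (1 / 2) *\<^sub>C (?X + ?X)"
      by (simp flip: scaleC_add_left add: scaleC_add_right)
    ultimately show ?thesis
      by (simp add: scaleC_scaleC)
  qed
  then show ?thesis
    by blast
qed

text \<open>Between two minimal projections the space \<open>s A r\<close> has dimension at most
  one: m m* is a multiple \<beta> of \<open>s\<close> and m* n a multiple \<alpha> of
  \<open>r\<close>, so m m* n computed in two ways gives \<beta> n = \<alpha> m.\<close>

lemma minimal_corner_proportional:
  assumes r: "r \<in> A" "projection r"
    and r_min: "\<forall>x\<in>A. \<exists>c. \<forall>v. r (x (r v)) = c *\<^sub>C r v"
    and s: "s \<in> A" "projection s"
    and s_min: "\<forall>x\<in>A. \<exists>c. \<forall>v. s (x (s v)) = c *\<^sub>C s v"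
    and m: "m \<in> A" "m \<noteq> 0" "\<And>v. s (m v) = m v" "\<And>v. m (r v) = m v"
    and n: "n \<in> A" "\<And>v. s (n v) = n v" "\<And>v. n (r v) = n v"
  shows "\<exists>c. \<forall>v. n v = c *\<^sub>C m v"
proof -
  obtain m' where m': "m' \<in> A" "is_adjoint m m'"
    using mem_adjoint m(1) by blast
  have s_adj: "is_adjoint s s" and r_adj: "is_adjoint r r"
    using s(2) r(2) by (simp_all add: projection_def)
  have "s o\<^sub>L m = m" "m o\<^sub>L r = m"
    by (auto intro!: blinfun_eqI simp: m)
  then have "m' o\<^sub>L s = m'" "r o\<^sub>L m' = m'"
    using is_adjoint_unique m'(2) is_adjoint_compose[OF s_adj m'(2)] is_adjoint_compose[OF m'(2) r_adj]
    by auto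
  then have m's: "m' (s v) = m' v" and rm': "r (m' v) = m' v" for v
    by (metis blinfun_apply_blinfun_compose)+
  obtain \<beta> where \<beta>: "\<And>v. s (m (m' (s v))) = \<beta> *\<^sub>C s v"
    using s_min mem_compose[OF m(1) m'(1)] by fastforce
  obtain \<alpha> where \<alpha>: "\<And>v. r (m' (n (r v))) = \<alpha> *\<^sub>C r v"
    using r_min mem_compose[OF m'(1) n(1)] by fastforce
  \<comment> \<open>A vanishing \<beta> would make m m* zero, hence \<open>m\<close> zero.\<close>
  have "m o\<^sub>L m' \<noteq> 0"
    using is_adjoint_compose_eq_0[OF is_adjoint_sym[OF m'(2)]] m(2) m'(2)
      is_adjoint_unique[OF is_adjoint_sym[OF m'(2)], of 0] is_adjoint_0 by auto
  then have "\<beta> \<noteq> 0"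
    using \<beta> m's m(3) by (auto intro!: blinfun_eqI)
  have "n v = (\<alpha> / \<beta>) *\<^sub>C m v" for v
  proof -
    have "\<beta> *\<^sub>C n v = \<beta> *\<^sub>C s (n v)"
      by (simp add: n)
    also have "\<dots> = m (m' (n v))"
      by (simp flip: \<beta> add: m's m(3))
    also have "\<dots> = m (\<alpha> *\<^sub>C r v)"
      by (simp flip: \<alpha> add: n(3) rm')
    also have "\<dots> = \<alpha> *\<^sub>C m v"
      by (simp add: bounded_scaleC m)
    finally have "(1 / \<beta>) *\<^sub>C \<beta> *\<^sub>C n v = (1 / \<beta>) *\<^sub>C \<alpha> *\<^sub>C m v"
      by simp
    then show ?thesis
      using \<open>\<beta> \<noteq> 0\<close> by (simp add: scaleC_scaleC)
  qed
  then show ?thesis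
    by blast
qed

end

text \<open>The cross product of the coefficient vectors is a solution whenever it is nonzero. The
  remaining cases treat proportional vectors by explicit solutions supported on the first two
  coordinates.\<close>

lemma two_equations_three_unknowns:
  fixes a b :: "nat \<Rightarrow> 'a :: field"
  shows "\<exists>x. (\<exists>i<3. x i \<noteq> 0) \<and> (\<Sum>i<3. x i * a i) = 0 \<and> (\<Sum>i<3. x i * b i) = 0"
proof -
  have sum3: "(\<Sum>i<3. f i) = f 0 + f 1 + f 2" for f :: "nat \<Rightarrow> 'a"
    by (simp add: eval_nat_numeral)
  have ex: ?thesis if "x \<noteq> 0 \<or> y \<noteq> 0 \<or> z \<noteq> 0" "x * a 0 + y * a 1 + z * a 2 = 0"
    "x * b 0 + y * b 1 + z * b 2 = 0" for x y z
  proof -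
    define X :: "nat \<Rightarrow> 'a" where "X i = (if i = 0 then x else if i = 1 then y else z)" for i
    have X: "X 0 = x" "X 1 = y" "X 2 = z"
      by (simp_all add: X_def)
    have "(0 :: nat) < 3" "(1 :: nat) < 3" "(2 :: nat) < 3"
      by simp_all
    then have "\<exists>i<3. X i \<noteq> 0"
      using that(1) unfolding X[symmetric] by blast
    moreover have "(\<Sum>i<3. X i * a i) = 0" "(\<Sum>i<3. X i * b i) = 0"
      using that(2,3) unfolding sum3 X by simp_all
    ultimately show ?thesis
      by blast
  qed
  consider "a 1 * b 2 - a 2 * b 1 \<noteq> 0 \<or> a 2 * b 0 - a 0 * b 2 \<noteq> 0 \<or> a 0 * b 1 - a 1 * b 0 \<noteq> 0"
    | "a 0 * b 1 = a 1 * b 0" "a 0 \<noteq> 0 \<or> a 1 \<noteq> 0"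
    | "a 0 = 0" "a 1 = 0" "a 2 = 0" "b 0 \<noteq> 0 \<or> b 1 \<noteq> 0"
    | "a 0 = 0" "b 0 = 0"
  proof (cases "a 0 = 0 \<and> a 1 = 0")
    case True
    then show ?thesis
      using that by (cases "a 2 = 0"; cases "b 0 = 0"; cases "b 1 = 0") auto
  next
    case False
    then show ?thesis
      using that(1,2) right_minus_eq by blast
  qed
  then show ?thesis
  proof cases
    case 1
    then show ?thesis
      by (rule ex) (simp_all add: algebra_simps)
  next
    case 2
    then show ?thesis
      by (intro ex[of "a 1" "- a 0" 0]) (auto simp: algebra_simps)
  next
    case 3
    then show ?thesis
      by (intro ex[of "b 1" "- b 0" 0]) (auto simp: algebra_simps)
  next
    case 4
    then show ?thesis
      by (intro ex[of 1 0 0]) auto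
  qed
qed

section \<open>Walks in the zero divisor graph\<close>

lemma relpow_sym: "sym R \<Longrightarrow> (a, b) \<in> R ^^ n \<Longrightarrow> (b, a) \<in> R ^^ n"
proof (induction n arbitrary: b)
  case (Suc n)
  then obtain c where "(a, c) \<in> R ^^ n" "(c, b) \<in> R"
    by auto
  then show ?case
    using Suc relpow_Suc_I2 symD by metis
qed simp

lemma pair_graph_awalk_relpow:
  assumes "wf_digraph (with_proj G)" and "(a, b) \<in> parcs G ^^ n" and "a \<in> pverts G"
  shows "\<exists>p. pre_digraph.awalk (with_proj G) a p b \<and> length p = n"
proof -
  interpret wf_digraph "with_proj G"
    by fact
  show ?thesis
    using assms(2,3)
  proof (induction n arbitrary: a)
    case 0
    then show ?case
      by (auto simp: awalk_Nil_iff)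
  next
    case (Suc n)
    then obtain c where c: "(a, c) \<in> parcs G" "(c, b) \<in> parcs G ^^ n"
      using relpow_Suc_D2 by metis
    then have "c \<in> pverts G"
      using head_in_verts[of "(a, c)"] by simp
    then obtain p where "awalk c p b" "length p = n"
      using Suc.IH c(2) by blast
    then show ?case
      using c(1) by (intro exI[of _ "(a, c) # p"]) (simp add: awalk_Cons_iff)
  qed
qed

text \<open>With unit weights the cost of a walk is its length. Walks may repeat vertices, so powers
  of the arc relation suffice for upper bounds on the distance.\<close>

lemma graph_dist_le:
  assumes "wf_digraph (with_proj G)" and "(a, b) \<in> parcs G ^^ n" and "a \<in> pverts G"
  shows "graph_dist (with_proj G) a b \<le> ereal n"
proof -
  interpret wf_digraph "with_proj G"
    by fact
  obtain p where p: "awalk a p b" "length p = n"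
    using pair_graph_awalk_relpow[OF assms] by blast
  have "awalk_cost (\<lambda>_. 1) p = real (length p)"
    by (induction p) (auto simp: awalk_cost_def)
  then show ?thesis
    using min_cost_le_walk_cost[OF p(1), of "\<lambda>_. 1"] p(2) by (simp add: graph_dist_def)
qed

context von_neumann
begin

abbreviation E :: "(('h \<Rightarrow>\<^sub>L 'h) \<times> ('h \<Rightarrow>\<^sub>L 'h)) set" where
  "E \<equiv> parcs (zero_divisor_graph A)"

lemma positive_self_adjoint: "a \<in> A \<Longrightarrow> positive_operator a \<Longrightarrow> is_adjoint a a"
  using positive_operator_is_adjoint mem_adjoint mem_bounded by blast

text \<open>Each of \<open>a\<close> and \<open>b\<close> witnesses that the other is a zero
  divisor, one direction needing adjoints. They are distinct because a self-adjoint operator with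
  square 0 is 0.\<close>

lemma edgeI:
  assumes "a \<in> A" "positive_operator a" "a \<noteq> 0" and "b \<in> A" "positive_operator b" "b \<noteq> 0"
    and ab: "\<And>x. a (b x) = 0"
  shows "(a, b) \<in> E"
proof -
  have adj: "is_adjoint a a" "is_adjoint b b"
    using assms positive_self_adjoint by auto
  have "a o\<^sub>L b = 0"
    by (rule blinfun_eqI) (simp add: ab)
  moreover from this have "b o\<^sub>L a = 0"
    by (rule self_adjoint_compose_commute[OF adj])
  moreover have "a \<noteq> b"
    using is_adjoint_compose_eq_0[OF adj(1)] \<open>a o\<^sub>L b = 0\<close> assms(3) by auto
  ultimately show ?thesis
    using assms by (auto simp: zero_divisor_graph_def positive_zero_divisors_def)
qed

lemma sym_edges: "sym E"
proof (rule symI)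
  fix a b assume ab: "(a, b) \<in> E"
  then have "is_adjoint a a" "is_adjoint b b" "a o\<^sub>L b = 0"
    by (auto simp: zero_divisor_graph_def positive_zero_divisors_def positive_self_adjoint)
  then have "b o\<^sub>L a = 0"
    by (rule self_adjoint_compose_commute)
  then show "(b, a) \<in> E"
    using ab by (auto simp: zero_divisor_graph_def)
qed

lemma wf_zero_divisor_graph: "wf_digraph (with_proj (zero_divisor_graph A))"
  by unfold_locales (auto simp: zero_divisor_graph_def)

lemma zero_divisor_kernel:
  assumes "a \<in> positive_zero_divisors A"
  obtains p where "p \<in> A" "projection p" "p \<noteq> 0" "p \<noteq> id_blinfun" "\<And>x. p x = x \<longleftrightarrow> a x = 0"
proof -
  have a: "a \<in> A" "is_adjoint a a" "a \<noteq> 0"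
    using assms positive_self_adjoint by (auto simp: positive_zero_divisors_def)
  obtain b :: "'h \<Rightarrow>\<^sub>L 'h" where b: "b \<noteq> 0" "a o\<^sub>L b = 0"
    using assms unfolding positive_zero_divisors_def by blast
  obtain p where p: "p \<in> A" "projection p" "\<And>x. p x = x \<longleftrightarrow> a x = 0"
    using kernel_projection[OF a(1,2)] by metis
  have "p (b x) = b x" for x
    using arg_cong[OF b(2), of "\<lambda>T. blinfun_apply T x"] p(3) by simp
  then have "b = 0" if "p = 0"
    by (intro blinfun_eqI) (simp add: that)
  then have "p \<noteq> 0"
    using b(1) by blast
  moreover have "a = 0" if "p = id_blinfun"
    using p(3) by (intro blinfun_eqI) (simp add: that)
  then have "p \<noteq> id_blinfun"
    using a(3) by blast
  ultimately show thesis
    using that p by blast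
qed

lemma complement_projection:
  "p \<in> A \<Longrightarrow> projection p \<Longrightarrow> id_blinfun - p \<in> A \<and> projection (id_blinfun - p)"
  by (auto intro!: blinfun_eqI mem_diff mem_id is_adjoint_diff is_adjoint_id
      simp: projection_def projection_apply blinfun.bilinear_simps)

lemma square_positive: "u \<in> A \<Longrightarrow> is_adjoint u u \<Longrightarrow> u \<noteq> 0 \<Longrightarrow>
    u o\<^sub>L u \<in> A \<and> positive_operator (u o\<^sub>L u) \<and> u o\<^sub>L u \<noteq> 0"
  using mem_compose positive_operator_adjoint_compose is_adjoint_compose_eq_0 by blast

text \<open>The walks built here have length 3 or 5.\<close>

lemma walk_nonminimal:
  assumes a: "a \<in> positive_zero_divisors A" and b: "b \<in> positive_zero_divisors A"
    and p: "p \<in> A" "projection p" "p \<noteq> 0" "\<And>x. p x = x \<longleftrightarrow> a x = 0"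
    and q: "q \<in> A" "projection q" "q \<noteq> 0" "\<And>x. q x = x \<longleftrightarrow> b x = 0"
    and h: "h \<in> A" "is_adjoint h h" "(id_blinfun - p) o\<^sub>L h = h"
    and nonscalar: "\<And>c :: real. h \<noteq> c *\<^sub>R (id_blinfun - p)"
  shows "\<exists>n\<le>6. (a, b) \<in> E ^^ n"
proof -
  have a': "a \<in> A" "positive_operator a" "a \<noteq> 0" and b': "b \<in> A" "positive_operator b" "b \<noteq> 0"
    using a b by (auto simp: positive_zero_divisors_def)
  have p': "p \<in> A" "positive_operator p" "p \<noteq> 0" and q': "q \<in> A" "positive_operator q" "q \<noteq> 0"
    using p q projection_positive by auto
  define s where "s = id_blinfun - q"
  have s: "s \<in> A" "projection s" "is_adjoint s s"
    using complement_projection[OF q(1,2)] by (auto simp: s_def projection_def)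
  have r: "id_blinfun - p \<in> A" "projection (id_blinfun - p)"
    using complement_projection[OF p(1,2)] by auto
  obtain u v where u: "u \<in> A" "is_adjoint u u" "u \<noteq> 0" "(id_blinfun - p) o\<^sub>L u = u"
    and v: "v \<in> A" "is_adjoint v v" "v \<noteq> 0" "(id_blinfun - p) o\<^sub>L v = v"
    and usv: "u o\<^sub>L s o\<^sub>L v = 0"
    using corner_orthogonal_through[OF r s(1,3) h nonscalar] by metis
  have pu: "p (u x) = 0" and pv: "p (v x) = 0" for x
    using arg_cong[OF u(4), of "\<lambda>T. blinfun_apply T x"] arg_cong[OF v(4), of "\<lambda>T. blinfun_apply T x"]
    by (simp_all add: blinfun.bilinear_simps)
  have ap: "(a, p) \<in> E"
    by (rule edgeI[OF a' p']) (metis p(2,4) projection_apply)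
  have qb: "(q, b) \<in> E"
    by (rule symD[OF sym_edges], rule edgeI[OF b' q']) (metis q(2,4) projection_apply)
  show ?thesis
  proof (cases "s o\<^sub>L v = 0")
    case True
    \<comment> \<open>Here the range of \<open>v\<close> lies in the kernel of \<open>b\<close>, so
      the square of \<open>v\<close> is adjacent to \<open>b\<close> directly.\<close>
    have "q (v x) = v x" for x
      using arg_cong[OF True, of "\<lambda>T. blinfun_apply T x"] by (simp add: s_def blinfun.bilinear_simps)
    then have "b (v x) = 0" for x
      using q(4) by blast
    moreover have v2: "v o\<^sub>L v \<in> A" "positive_operator (v o\<^sub>L v)" "v o\<^sub>L v \<noteq> 0"
      using square_positive v by auto
    ultimately have "(b, v o\<^sub>L v) \<in> E"
      by (intro edgeI[OF b' v2]) simp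
    then have "(v o\<^sub>L v, b) \<in> E"
      using sym_edges symD by metis
    moreover have "(p, v o\<^sub>L v) \<in> E"
      by (rule edgeI[OF p' v2]) (simp add: pv)
    ultimately have "(a, b) \<in> E ^^ 3"
      using ap by (auto simp: eval_nat_numeral)
    then show ?thesis
      by (intro exI[of _ 3]) simp
  next
    case False
    define x where "x = u o\<^sub>L u"
    have x: "x \<in> A" "positive_operator x" "x \<noteq> 0"
      using square_positive u by (auto simp: x_def)
    define w where "w = s o\<^sub>L v"
    \<comment> \<open>This is w w* = s v^2 s: it is positive, killed by \<open>q\<close> because of
      the outer \<open>s\<close>, and killed by \<open>x\<close> because \<open>u\<close>
      annihilates \<open>s v\<close>.\<close>
    define y where "y = w o\<^sub>L (v o\<^sub>L s)"
    have w: "is_adjoint w (v o\<^sub>L s)" "w \<in> A" "v o\<^sub>L s \<in> A"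
      using is_adjoint_compose[OF s(3) v(2)] by (auto simp: w_def mem_compose s v)
    have "v o\<^sub>L s \<noteq> 0"
      using is_adjoint_unique[OF is_adjoint_sym[OF w(1)], of 0] False is_adjoint_0 by (auto simp: w_def)
    then have y: "y \<in> A" "positive_operator y" "y \<noteq> 0"
      using mem_compose[OF w(2,3)] positive_operator_adjoint_compose[OF is_adjoint_sym[OF w(1)]]
        is_adjoint_compose_eq_0[OF is_adjoint_sym[OF w(1)]] by (auto simp: y_def)
    have "(p, x) \<in> E"
      by (rule edgeI[OF p' x]) (simp add: x_def pu)
    moreover have "(x, y) \<in> E"
    proof (rule edgeI[OF x y])
      have "u (s (v z)) = 0" for z
        using arg_cong[OF usv, of "\<lambda>T. blinfun_apply T z"] by simp
      then show "x (y z) = 0" for z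
        by (simp add: x_def y_def w_def)
    qed
    moreover have "(q, y) \<in> E"
      by (rule edgeI[OF q' y])
        (simp add: y_def w_def s_def blinfun.bilinear_simps projection_apply[OF q(2)])
    then have "(y, q) \<in> E"
      using sym_edges symD by metis
    ultimately have "(a, b) \<in> E ^^ 5"
      using ap qb by (auto simp: eval_nat_numeral)
    then show ?thesis
      by (intro exI[of _ 5]) simp
  qed
qed

lemma common_annihilator_of_minimal:
  assumes prime: "\<forall>x\<in>A. \<forall>y\<in>A. (\<forall>u\<in>A. y o\<^sub>L u o\<^sub>L x = 0) \<longrightarrow> x = 0 \<or> y = 0"
    and e: "\<forall>i<3 :: nat. e i \<in> A \<and> projection (e i) \<and> e i \<noteq> 0"
    and orth: "\<forall>i<3. \<forall>j<3. i \<noteq> j \<longrightarrow> e i o\<^sub>L e j = 0"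
    and r: "r \<in> A" "projection r" "r \<noteq> 0"
    and r_min: "\<forall>x\<in>A. \<exists>c. \<forall>v. r (x (r v)) = c *\<^sub>C r v"
    and s: "s \<in> A" "projection s"
    and s_min: "\<forall>x\<in>A. \<exists>c. \<forall>v. s (x (s v)) = c *\<^sub>C s v"
  obtains w where "w \<in> A" "w \<noteq> 0" "\<And>x. r (w x) = 0" "\<And>x. s (w x) = 0"
proof -
  have rr: "r (r x) = r x" and ss: "s (s x) = s x" for x
    using projection_apply r(2) s(2) by auto
  have "\<forall>i. \<exists>u. i < 3 \<longrightarrow> u \<in> A \<and> e i o\<^sub>L u o\<^sub>L r \<noteq> 0"
    using prime r(1,3) e by metis
  then obtain u where u: "\<And>i. i < 3 \<Longrightarrow> u i \<in> A \<and> e i o\<^sub>L u i o\<^sub>L r \<noteq> 0"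
    by metis
  define W where "W i = e i o\<^sub>L u i o\<^sub>L r" for i
  have W: "W i \<in> A" "W i \<noteq> 0" if "i < 3" for i
    using u[OF that] e that r(1) by (auto simp: W_def mem_compose)
  have Wr: "W i (r x) = W i x" for i x
    by (simp add: W_def rr)
  have eW: "e j (W i x) = (if i = j then W i x else 0)" if "i < 3" "j < 3" for i j x
  proof (cases "i = j")
    case True
    then show ?thesis
      using e that(1) by (simp add: W_def projection_apply)
  next
    case False
    then have "(e j o\<^sub>L e i) y = 0" for y
      using orth that by simp
    then show ?thesis
      using False by (simp add: W_def)
  qed
  \<comment> \<open>As \<open>W i\<close> absorbs \<open>r\<close> on the right,
    \<open>r (W i x)\<close> comes from the corner of \<open>r\<close> and is a scalar multiple of
    \<open>r x\<close>.\<close>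
  have "\<forall>i. \<exists>c. i < 3 \<longrightarrow> (\<forall>x. r (W i x) = c *\<^sub>C r x)"
    using r_min W(1) Wr by metis
  then obtain \<rho> where \<rho>: "\<And>i x. i < 3 \<Longrightarrow> r (W i x) = \<rho> i *\<^sub>C r x"
    by metis
  \<comment> \<open>All compositions of \<open>s\<close> with the \<open>W i\<close> lie on one
    line. A nonzero one serves as the generator \<open>m\<close>; if all vanish,
    \<open>m = 0\<close> fits any coefficients.\<close>
  have "\<exists>m \<sigma>. \<forall>i<3. \<forall>x. s (W i x) = \<sigma> i *\<^sub>C blinfun_apply m x"
  proof (cases "\<exists>j<3. s o\<^sub>L W j \<noteq> 0")
    case True
    then obtain j where j: "j < 3" "s o\<^sub>L W j \<noteq> 0"
      by blast
    have "\<exists>c. \<forall>x. (s o\<^sub>L W i) x = c *\<^sub>C (s o\<^sub>L W j) x" if "i < 3" for i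
      by (rule minimal_corner_proportional[OF r(1,2) r_min s s_min])
        (use j that in \<open>auto simp: mem_compose s W ss Wr\<close>)
    then have "\<forall>i. \<exists>c. i < 3 \<longrightarrow> (\<forall>x. s (W i x) = c *\<^sub>C (s o\<^sub>L W j) x)"
      by auto
    then show ?thesis
      by metis
  next
    case False
    then have "s (W i x) = 0" if "i < 3" for i x
      using that by (metis blinfun_apply_blinfun_compose zero_blinfun.rep_eq)
    then show ?thesis
      by (intro exI[of _ 0]) simp
  qed
  then obtain m \<sigma> where \<sigma>: "\<And>i x. i < 3 \<Longrightarrow> s (W i x) = \<sigma> i *\<^sub>C blinfun_apply m x"
    by blast
  obtain \<alpha> j where \<alpha>: "j < 3" "\<alpha> j \<noteq> 0" "(\<Sum>i<3. \<alpha> i * \<rho> i) = 0" "(\<Sum>i<3. \<alpha> i * \<sigma> i) = 0"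
    using two_equations_three_unknowns[of \<rho> \<sigma>] by blast
  define w where "w = (\<Sum>i<3. scaleC_op (\<alpha> i) (W i))"
  have w_apply: "w x = (\<Sum>i<3. \<alpha> i *\<^sub>C W i x)" for x
    by (simp add: w_def blinfun.sum_left scaleC_op.rep_eq)
  have "w \<in> A"
    by (auto simp: w_def intro!: mem_sum mem_scaleC W)
  moreover have "w \<noteq> 0"
  proof
    assume "w = 0"
    \<comment> \<open>Applying \<open>e j\<close> isolates the \<open>j\<close>-th summand, since
      the ranges of the \<open>W i\<close> lie in those of the orthogonal
      \<open>e i\<close>.\<close>
    have "\<alpha> j *\<^sub>C W j x = 0" for x
    proof -
      have "0 = e j (w x)"
        by (simp add: \<open>w = 0\<close>)
      also have "\<dots> = (\<Sum>i<3. \<alpha> i *\<^sub>C e j (W i x))"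
        using e \<alpha>(1) by (simp add: w_apply blinfun.sum_right bounded_scaleC)
      also have "\<dots> = (\<Sum>i<3. if i = j then \<alpha> j *\<^sub>C W j x else 0)"
        by (rule sum.cong) (auto simp: eW \<alpha>(1))
      also have "\<dots> = \<alpha> j *\<^sub>C W j x"
        using \<alpha>(1) by simp
      finally show ?thesis
        by simp
    qed
    then have "W j = 0"
      using \<alpha>(2) by (intro blinfun_eqI) simp
    then show False
      using W(2)[OF \<alpha>(1)] by blast
  qed
  moreover have "r (w x) = 0" for x
  proof -
    have "r (w x) = (\<Sum>i<3. (\<alpha> i * \<rho> i) *\<^sub>C r x)"
      by (simp add: w_apply blinfun.sum_right bounded_scaleC r \<rho> scaleC_scaleC)
    then show ?thesis
      unfolding complex_vector.scale_sum_left[symmetric] \<alpha> by simp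
  qed
  moreover have "s (w x) = 0" for x
  proof -
    have "s (w x) = (\<Sum>i<3. (\<alpha> i * \<sigma> i) *\<^sub>C m x)"
      by (simp add: w_apply blinfun.sum_right bounded_scaleC s \<sigma> scaleC_scaleC)
    then show ?thesis
      unfolding complex_vector.scale_sum_left[symmetric] \<alpha> by simp
  qed
  ultimately show thesis
    using that by blast
qed

lemma walk_le_6:
  assumes prime: "\<forall>x\<in>A. \<forall>y\<in>A. (\<forall>u\<in>A. y o\<^sub>L u o\<^sub>L x = 0) \<longrightarrow> x = 0 \<or> y = 0"
    and e: "\<forall>i<3 :: nat. e i \<in> A \<and> projection (e i) \<and> e i \<noteq> 0"
    and orth: "\<forall>i<3. \<forall>j<3. i \<noteq> j \<longrightarrow> e i o\<^sub>L e j = 0"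
    and a: "a \<in> positive_zero_divisors A" and b: "b \<in> positive_zero_divisors A"
  shows "\<exists>n\<le>6. (a, b) \<in> E ^^ n"
proof -
  obtain p where p: "p \<in> A" "projection p" "p \<noteq> 0" "p \<noteq> id_blinfun" "\<And>x. p x = x \<longleftrightarrow> a x = 0"
    using zero_divisor_kernel[OF a] by metis
  obtain q where q: "q \<in> A" "projection q" "q \<noteq> 0" "q \<noteq> id_blinfun" "\<And>x. q x = x \<longleftrightarrow> b x = 0"
    using zero_divisor_kernel[OF b] by metis
  define r where "r = id_blinfun - p"
  define s where "s = id_blinfun - q"
  have r: "r \<in> A" "projection r" "r \<noteq> 0" and s: "s \<in> A" "projection s"
    using complement_projection p q by (auto simp: r_def s_def)
  consider h where "h \<in> A" "is_adjoint h h" "r o\<^sub>L h = h" "\<And>c :: real. h \<noteq> c *\<^sub>R r"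
    | h where "h \<in> A" "is_adjoint h h" "s o\<^sub>L h = h" "\<And>c :: real. h \<noteq> c *\<^sub>R s"
    | "\<forall>h\<in>A. is_adjoint h h \<longrightarrow> r o\<^sub>L h = h \<longrightarrow> (\<exists>c :: real. h = c *\<^sub>R r)"
      "\<forall>h\<in>A. is_adjoint h h \<longrightarrow> s o\<^sub>L h = h \<longrightarrow> (\<exists>c :: real. h = c *\<^sub>R s)"
    by metis
  then show ?thesis
  proof cases
    case 1
    then show ?thesis
      unfolding r_def by (intro walk_nonminimal[OF a b p(1,2,3,5) q(1,2,3,5)])
  next
    case 2
    then have "\<exists>n\<le>6. (b, a) \<in> E ^^ n"
      unfolding s_def by (intro walk_nonminimal[OF b a q(1,2,3,5) p(1,2,3,5)])
    then show ?thesis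
      using relpow_sym[OF sym_edges] by blast
  next
    case 3
    have "\<forall>x\<in>A. \<exists>c. \<forall>v. r (x (r v)) = c *\<^sub>C r v" "\<forall>x\<in>A. \<exists>c. \<forall>v. s (x (s v)) = c *\<^sub>C s v"
      using minimal_corner_scalar r(1,2) s 3 by blast+
    then obtain w where w: "w \<in> A" "w \<noteq> 0" "\<And>x. r (w x) = 0" "\<And>x. s (w x) = 0"
      using common_annihilator_of_minimal[OF prime e orth r _ s] by metis
    obtain w' where w': "w' \<in> A" "is_adjoint w w'"
      using mem_adjoint w(1) by blast
    have "w' \<noteq> 0"
      using is_adjoint_unique[OF is_adjoint_sym[OF w'(2)], of 0] w(2) w'(2) is_adjoint_0 by auto
    \<comment> \<open>The range of \<open>z\<close> lies in that of \<open>w\<close>, hence in both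
      kernels: \<open>r (w x) = 0\<close> says that \<open>p\<close> fixes \<open>w x\<close>, and
      likewise for \<open>s\<close> and \<open>q\<close>.\<close>
    define z where "z = w o\<^sub>L w'"
    have z: "z \<in> A" "positive_operator z" "z \<noteq> 0"
      using mem_compose[OF w(1) w'(1)] positive_operator_adjoint_compose[OF is_adjoint_sym[OF w'(2)]]
        is_adjoint_compose_eq_0[OF is_adjoint_sym[OF w'(2)]] \<open>w' \<noteq> 0\<close> by (auto simp: z_def)
    have "a (w x) = 0" "b (w x) = 0" for x
      using w(3,4)[of x] p(5)[of "w x"] q(5)[of "w x"]
      by (auto simp: r_def s_def blinfun.bilinear_simps)
    then have "(a, z) \<in> E" "(b, z) \<in> E"
      using a b by (auto intro!: edgeI z simp: positive_zero_divisors_def z_def[symmetric])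
         (auto simp: z_def)
    then have "(a, b) \<in> E ^^ 2"
      using symD[OF sym_edges] by (auto simp: eval_nat_numeral)
    then show ?thesis
      by (intro exI[of _ 2]) simp
  qed
qed

end

text \<open>A supremum of cardinalities that is at least 3 is not bounded by 2, so some orthogonal
  family has at least 3 members.\<close>

lemma three_orthogonal_projections:
  assumes "factor_dim A \<ge> 3"
  obtains e where "\<forall>i<3 :: nat. e i \<in> A \<and> projection (e i) \<and> e i \<noteq> 0"
    "\<forall>i<3. \<forall>j<3. i \<noteq> j \<longrightarrow> e i o\<^sub>L e j = 0"
proof -
  define \<F> where "\<F> = {F. finite F \<and> F \<subseteq> {P \<in> A. projection P \<and> P \<noteq> 0} \<and>
                  pairwise (\<lambda>P Q. P o\<^sub>L Q = 0) F}"
  have "\<exists>F\<in>\<F>. 3 \<le> card F"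
  proof (rule ccontr)
    assume "\<not> ?thesis"
    then have "enat (card F) \<le> 2" if "F \<in> \<F>" for F
      using that by (auto simp: numeral_eq_enat not_le)
    then have "factor_dim A \<le> 2"
      unfolding factor_dim_def \<F>_def[symmetric] by (rule SUP_least)
    then have "(3 :: enat) \<le> 2"
      using assms order_trans by blast
    then show False
      by (simp add: numeral_eq_enat)
  qed
  then obtain F where F: "F \<in> \<F>" "3 \<le> card F"
    by blast
  then obtain G where G: "G \<subseteq> F" "card G = 3" "finite G"
    using obtain_subset_with_card_n by metis
  obtain e where e: "bij_betw e {..<3 :: nat} G"
    using G by (metis atLeast0LessThan ex_bij_betw_nat_finite)
  have "e i \<in> A \<and> projection (e i) \<and> e i \<noteq> 0" if "i < 3" for i
    using that bij_betwE[OF e] G(1) F(1) by (auto simp: \<F>_def)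
  moreover have "e i o\<^sub>L e j = 0" if "i < 3" "j < 3" "i \<noteq> j" for i j
  proof -
    have "e i \<in> F" "e j \<in> F" "e i \<noteq> e j"
      using that bij_betwE[OF e] G(1) bij_betw_imp_inj_on[OF e] by (auto dest: inj_onD)
    then show ?thesis
      using F(1) by (auto simp: \<F>_def pairwise_def)
  qed
  ultimately show thesis
    using that[of e] by blast
qed

theorem corollary5:
  fixes A :: "('h :: complex_hilbert_space \<Rightarrow>\<^sub>L 'h) set"
  assumes "infinite_dimensional TYPE('h)"
    and "separable TYPE('h)"
    and "factor A"
    and "factor_dim A \<ge> 3"
  shows "Digraph_Component.connected (with_proj (zero_divisor_graph A))
    \<and> graph_diameter (with_proj (zero_divisor_graph A)) \<le> 6"
proof -
  interpret von_neumann A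
    using assms(3) by unfold_locales (simp add: factor_def)
  let ?G = "zero_divisor_graph A"
  interpret wf_digraph "with_proj ?G"
    by (rule wf_zero_divisor_graph)
  obtain e where e: "\<forall>i<3 :: nat. e i \<in> A \<and> projection (e i) \<and> e i \<noteq> 0"
    "\<forall>i<3. \<forall>j<3. i \<noteq> j \<longrightarrow> e i o\<^sub>L e j = 0"
    using three_orthogonal_projections[OF assms(4)] by blast
  have "center A = range (\<lambda>c. scaleC_op c id_blinfun)"
    using assms(3) by (simp add: factor_def)
  then have prime: "\<forall>x\<in>A. \<forall>y\<in>A. (\<forall>u\<in>A. y o\<^sub>L u o\<^sub>L x = 0) \<longrightarrow> x = 0 \<or> y = 0"
    using factor_prime[OF assms(2)] by blast
  have verts: "verts (with_proj ?G) = positive_zero_divisors A"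
    by (simp add: zero_divisor_graph_def)
  have walk: "\<exists>n\<le>6. (a, b) \<in> parcs ?G ^^ n"
    if "a \<in> verts (with_proj ?G)" "b \<in> verts (with_proj ?G)" for a b
    using walk_le_6[OF prime e] that unfolding verts by simp
  \<comment> \<open>Strong connectedness demands a nonempty vertex set; \<open>e 0\<close> is a
    vertex because \<open>e 1\<close> annihilates it.\<close>
  have "e 0 \<in> verts (with_proj ?G)"
    using e(1)[rule_format, of 0] e(1)[rule_format, of 1] e(2)[rule_format, of 0 1]
    unfolding verts by (auto simp: positive_zero_divisors_def projection_positive)
  moreover have "a \<rightarrow>\<^sup>*\<^bsub>with_proj ?G\<^esub> b"
    if ab: "a \<in> verts (with_proj ?G)" "b \<in> verts (with_proj ?G)" for a b
    using walk[OF ab] pair_graph_awalk_relpow[OF wf_zero_divisor_graph] ab(1) reachable_awalk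
    by (metis with_proj_simps(1))
  ultimately have "strongly_connected (with_proj ?G)"
    by (auto simp: strongly_connected_def)
  \<comment> \<open>Connectedness is strong connectedness of the symmetric closure, which inherits
    reachability.\<close>
  then have "connected (with_proj ?G)"
    using reachable_mk_symmetricI by (auto simp: connected_def strongly_connected_def)
  moreover have "graph_dist (with_proj ?G) a b \<le> 6"
    if ab: "a \<in> verts (with_proj ?G)" "b \<in> verts (with_proj ?G)" for a b
  proof -
    obtain n where "n \<le> 6" "(a, b) \<in> parcs ?G ^^ n"
      using walk[OF ab] by blast
    then have "graph_dist (with_proj ?G) a b \<le> ereal n"
      using graph_dist_le[OF wf_zero_divisor_graph] ab(1) by simp
    also have "\<dots> \<le> 6"
      using \<open>n \<le> 6\<close> by simp
    finally show ?thesis .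
  qed
  then have "graph_diameter (with_proj ?G) \<le> 6"
    unfolding graph_diameter_def by (intro SUP_least) auto
  ultimately show ?thesis
    by simp
qed

end
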